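(* Let $q$ be a prime power, and let $a(q)=1$ if $2\mid q$ and $a(q)=0$ if $2\nmid q$. Then \begin{align*} C_{4,4}(q) &= (q^2+q+1)(q^2+1)(q+1)^2q^6,\\ C_{5,4}(q) &= (q^2+q+1)(q^2+1)(q+1)^2(q-1)^3q^6,\\ C_{6,4}(q) &= (q^2+q+1)(q^2+1)(q+1)^2(q-1)^3(q-2)(q-3)(q-4)q^6,\\ C_{7,4}(q) &= (q^2+q+1)(q^2+1)(q+1)^2(q-1)^3q^6\bigl(q^6-28q^5+323q^4-1952q^3+6462q^2-11004q+7470-30a(q)\bigr). \end{align*}
   Context: An $n$-arc in projective 3-space $\mathbb{P}^3(\mathbb{F}_q)$ over the finite field $\mathbb{F}_q$ is a set of $n$ points no $4$ of which lie on a plane. $C_{n,4}(q)$ denotes the number of ordered $n$-arcs in $\mathbb{P}^3(\mathbb{F}_q)$, i.e. of $n$-tuples of distinct points whose underlying set is an $n$-arc. *)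

theory Defs
  imports "HOL-Analysis.Analysis" "HOL-Number_Theory.Prime_Powers"
begin

text \<open>
  Projective 3-space over a field \<open>'a\<close>: points and planes are the linear subspaces of
  \<open>'a ^ 4\<close> of vector-space dimension 1 and 3, and incidence is inclusion.
\<close>

definition proj_points :: "('a::field ^ 4) set set" where
  "proj_points = {P. vec.subspace P \<and> vec.dim P = 1}"

definition proj_planes :: "('a::field ^ 4) set set" where
  "proj_planes = {H. vec.subspace H \<and> vec.dim H = 3}"

definition coplanar_points :: "('a::field ^ 4) set set \<Rightarrow> bool" where
  "coplanar_points T \<longleftrightarrow> (\<exists>H\<in>proj_planes. \<forall>P\<in>T. P \<subseteq> H)"

definition is_arc :: "nat \<Rightarrow> ('a::field ^ 4) set set \<Rightarrow> bool" where
  "is_arc n S \<longleftrightarrow> S \<subseteq> proj_points \<and> finite S \<and> card S = n \<and>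
     (\<forall>T\<subseteq>S. card T = 4 \<longrightarrow> \<not> coplanar_points T)"

definition ordered_arcs :: "nat \<Rightarrow> ('a::field ^ 4) set list set" where
  "ordered_arcs n = {ps. length ps = n \<and> distinct ps \<and> is_arc n (set ps)}"

text \<open>
  The argument of type \<open>'a itself\<close> selects the field: if \<open>'a\<close> has \<open>q\<close> elements, then
  \<open>num_ordered_arcs TYPE('a) n\<close> is \<open>C\<^bsub>n,4\<^esub>(q)\<close>.
\<close>

definition num_ordered_arcs :: "'a::{field,finite} itself \<Rightarrow> nat \<Rightarrow> nat" where
  "num_ordered_arcs _ n = card (ordered_arcs n :: ('a ^ 4) set list set)"

end

theory Submission
  imports Defs "HOL-Number_Theory.Residues"
begin

text \<open>
  Representing points by vectors turns an ordered \<open>n\<close>-arc into \<open>(q - 1)\<^sup>n\<close> lists of vectors any four of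
  which are independent, and the action of \<open>GL\<^sub>4\<close> moves the first four vectors to the standard basis.
  For seven points there remain the \<open>3 \<times> 4\<close> matrices all of whose minors are nonzero; transposing them
  (Gale duality) identifies this with the count of seven-point arcs in the projective plane.

  In the plane, a seventh point has to avoid the 15 lines through pairs of points of a six-arc. Off the
  arc, lines sharing one of the six points do not meet again, so inclusion-exclusion runs over the
  matchings of \<open>K\<^sub>6\<close>: 15 lines, 45 pairs of disjoint lines, and 15 triples of disjoint lines, the last ones
  contributing only if concurrent. Hence the number of choices is \<open>q\<^sup>2 - 14 q + 55\<close> minus the number of
  concurrent triples. By symmetry it suffices to count six-arcs for which one fixed triple
  is concurrent; in suitable coordinates two exceptional values coincide precisely in characteristic 2,
  which is where \<open>a(q)\<close> comes from.
\<close>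

section \<open>Generic lists of vectors and the action of the general linear group\<close>

text \<open>In 3-space a seventh point would have to avoid the 20 planes through triples of a
  six-arc, and many of these can pass through one point. After duality the obstacle is a set of 15
  lines of which at most three meet at a point off the arc, so inclusion-exclusion stops at the
  triple terms and becomes a finite check. Duality needs little in coordinates: next to the standard
  basis every determinant is, up to sign, a minor of the remaining block, and transposition only
  permutes the minors. Vectors are counted instead of points because the linear group acts freely on
  generic lists that contain a basis and because scalars can be split off as independent factors.
  Each normalization leaves a power of q - 1, and these powers are cancelled only at the end. The
  intermediate counts are integer identities valid for every finite field; for small q both sides
  may vanish. The coefficient 30 of a(q) is 15, the number of perfect matchings, times 2, the number
  of values of x that are exceptional only in odd characteristic.\<close>

text \<open>
  The condition refers to positions in the list, so repeated entries are excluded and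
  rearrangements need no separate treatment.
\<close>

definition generic :: "('a::field ^ 'n) list \<Rightarrow> bool" where
  "generic vs \<longleftrightarrow> (\<forall>f :: 'n \<Rightarrow> nat. inj f \<longrightarrow> range f \<subseteq> {..<length vs} \<longrightarrow> det (\<chi> i. vs ! f i) \<noteq> 0)"

text \<open>The identity matrix as a list of rows. The order of the coordinates is passed as
  \<open>es\<close>, since a finite index type need not carry one.\<close>

definition frame :: "'n list \<Rightarrow> ('a::field ^ 'n) list" where
  "frame es = map (\<lambda>i. axis i 1) es"

text \<open>Vectors are treated as rows, so multiplying every entry by \<open>M\<close> on the right
  multiplies each selected square matrix by \<open>M\<close> and each determinant by
  \<open>det M\<close>.\<close>

lemma generic_map_mult:
  fixes M :: "'a::field ^ 'n ^ 'n"
  assumes "det M \<noteq> 0"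
  shows "generic (map (\<lambda>x. x v* M) xs) \<longleftrightarrow> generic xs"
proof -
  have "det (\<chi> i. map (\<lambda>x. x v* M) xs ! f i) = det (\<chi> i. xs ! f i) * det M"
    if "range f \<subseteq> {..<length xs}" for f :: "'n \<Rightarrow> nat"
  proof -
    have "f i < length xs" for i using that by auto
    then have "(\<chi> i. map (\<lambda>x. x v* M) xs ! f i) = (\<chi> i. xs ! f i) ** M"
      by (simp add: vec_eq_iff vector_matrix_mult_def matrix_matrix_mult_def)
    then show ?thesis by (simp add: det_mul)
  qed
  with assms show ?thesis by (auto simp: generic_def)
qed

lemma generic_append_left: "generic (xs @ ys) \<Longrightarrow> generic xs"
proof -
  assume g: "generic (xs @ ys)"
  show "generic xs" unfolding generic_def
  proof (intro allI impI)
    fix f :: "'b \<Rightarrow> nat" assume f: "inj f" "range f \<subseteq> {..<length xs}"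
    then have "f i < length xs" for i by auto
    then have "(\<chi> i. (xs @ ys) ! f i) = (\<chi> i. xs ! f i)" by (simp add: nth_append)
    moreover have "range f \<subseteq> {..<length (xs @ ys)}" using f by auto
    ultimately show "det (\<chi> i. xs ! f i) \<noteq> 0" using g f(1) unfolding generic_def by metis
  qed
qed

lemma axis_vector_matrix_mult: "axis i 1 v* M = (M :: 'a::field ^ 'n ^ 'm) $ i"
  by (simp add: vec_eq_iff vector_matrix_mult_def axis_def if_distrib[where f="\<lambda>x. x * _"] cong: if_cong)

lemma enumeration_index:
  assumes es: "distinct es" "set es = UNIV"
  obtains f where "\<And>i. f i < length es" "\<And>i. es ! f i = i"
    "\<And>j. j < length es \<Longrightarrow> f (es ! j) = j" "inj f"
proof -
  have "\<forall>i. \<exists>j. j < length es \<and> es ! j = i" using es(2) by (metis UNIV_I in_set_conv_nth)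
  then obtain f where f: "\<And>i. f i < length es" "\<And>i. es ! f i = i" by metis
  have "f (es ! j) = j" if "j < length es" for j
    using nth_eq_iff_index_eq[OF es(1) f(1) that, of "es ! j"] f(2)[of "es ! j"] by blast
  moreover have "inj f" by (metis f(2) injI)
  ultimately show ?thesis by (intro that[of f] f)
qed

text \<open>The first \<open>CARD('n)\<close> entries of a generic list form an invertible matrix
  \<open>M\<close>, and applying its inverse turns them into the standard basis. Hence the list
  amounts to \<open>M\<close> together with the normalized remaining entries. The predicate
  \<open>P\<close> may be any property invariant under the linear group; it is later taken to be
  trivial or \<open>concurrent\<close>.\<close>

lemma card_generic_frame:
  fixes es :: "'n::finite list" and P :: "('a::{field,finite} ^ 'n) list \<Rightarrow> bool"
  assumes es: "distinct es" "set es = UNIV"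
    and P: "\<And>M xs. det M \<noteq> 0 \<Longrightarrow> length xs = CARD('n) + k \<Longrightarrow> P (map (\<lambda>x. x v* M) xs) = P xs"
  shows "card {vs :: ('a ^ 'n) list. length vs = CARD('n) + k \<and> generic vs \<and> P vs} =
    card {M :: 'a ^ 'n ^ 'n. det M \<noteq> 0} *
    card {ys :: ('a ^ 'n) list. length ys = k \<and> generic (frame es @ ys) \<and> P (frame es @ ys)}"
    (is "card ?C = card ?A * card ?B")
proof -
  let ?g = "\<lambda>(M :: 'a ^ 'n ^ 'n, ys). map (\<lambda>x. x v* M) (frame es @ ys)"
  have len: "length es = CARD('n)" using es by (metis distinct_card)
  have fr: "map (\<lambda>x. x v* M) (frame es) = map (\<lambda>i. M $ i) es" for M :: "'a ^ 'n ^ 'n"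
    by (simp add: frame_def axis_vector_matrix_mult)
  obtain f :: "'n \<Rightarrow> nat" where f: "\<And>i. f i < length es" "\<And>i. es ! f i = i"
    and fes: "\<And>j. j < length es \<Longrightarrow> f (es ! j) = j" and injf: "inj f"
    by (rule enumeration_index[OF es]) (rule that)
  have inv: "\<exists>M'. M' ** M = mat 1" "\<exists>M'. M ** M' = mat 1" if "det M \<noteq> 0" for M :: "'a ^ 'n ^ 'n"
    using that invertible_det_nz[of M] unfolding invertible_def by auto
  have "bij_betw ?g (?A \<times> ?B) ?C"
    unfolding bij_betw_def
  proof
    show "inj_on ?g (?A \<times> ?B)"
    proof (rule inj_onI, clarify)
      fix M M' :: "'a ^ 'n ^ 'n" and ys ys' :: "('a ^ 'n) list"
      assume d: "det M \<noteq> 0" and l: "length ys' = length ys"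
        and eq: "map (\<lambda>x. x v* M) (frame es @ ys) = map (\<lambda>x. x v* M') (frame es @ ys')"
      from eq have "map (\<lambda>i. M $ i) es = map (\<lambda>i. M' $ i) es"
        and eq2: "map (\<lambda>x. x v* M) ys = map (\<lambda>x. x v* M') ys'"
        by (simp_all add: fr)
      then have M: "M = M'" using es(2) by (simp add: vec_eq_iff)
      obtain N where "M ** N = mat 1" using inv(2)[OF d] by auto
      then have "(x v* M) v* N = x" for x by (simp add: vector_matrix_mul_assoc)
      then have "inj (\<lambda>x. x v* M)" by (rule inj_on_inverseI)
      with eq2 show "M = M' \<and> ys = ys'" unfolding M by (simp add: inj_map_eq_map)
    qed
    show "?g ` (?A \<times> ?B) = ?C"
    proof (intro equalityI subsetI)
      fix vs assume "vs \<in> ?g ` (?A \<times> ?B)"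
      then obtain M ys where m: "det M \<noteq> 0" "length ys = k" "generic (frame es @ ys)" "P (frame es @ ys)"
        and vs: "vs = map (\<lambda>x. x v* M) (frame es @ ys)" by auto
      have l: "length (frame es @ ys) = CARD('n) + k" using m(2) len by (simp add: frame_def)
      show "vs \<in> ?C"
        unfolding vs mem_Collect_eq generic_map_mult[OF m(1)] P[OF m(1) l] length_map
        using l m by blast
    next
      fix vs assume vs: "vs \<in> ?C"
      \<comment> \<open>The rows of \<open>M\<close> are the leading entries of \<open>vs\<close>,
        placed at the indices where \<open>es\<close> lists them.\<close>
      define M where "M = (\<chi> i. vs ! f i)"
      have r: "range f \<subseteq> {..<length vs}" using f(1) vs len by (auto intro: trans_less_add1)
      have d: "det M \<noteq> 0" unfolding M_def using vs r injf by (auto simp: generic_def)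
      then obtain M' where M': "M' ** M = mat 1" using inv(1) by auto
      define ys where "ys = map (\<lambda>x. x v* M') (drop CARD('n) vs)"
      have "map (\<lambda>i. M $ i) es = take CARD('n) vs"
        by (rule nth_equalityI) (use vs len fes in \<open>auto simp: M_def\<close>)
      moreover have "map (\<lambda>x. x v* M) ys = drop CARD('n) vs"
        by (simp add: ys_def vector_matrix_mul_assoc M' o_def vector_matrix_mul_rid)
      ultimately have e: "map (\<lambda>x. x v* M) (frame es @ ys) = vs" by (simp add: fr)
      have l: "length ys = k" using vs by (simp add: ys_def)
      have "generic (frame es @ ys)" using generic_map_mult[OF d, of "frame es @ ys"] vs unfolding e by auto
      moreover have "P (frame es @ ys)" using P[OF d, of "frame es @ ys"] vs l len unfolding e by (auto simp: frame_def)
      ultimately have "(M, ys) \<in> ?A \<times> ?B" using d l by auto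
      then show "vs \<in> ?g ` (?A \<times> ?B)" by (rule image_eqI[rotated]) (simp only: prod.case e)
    qed
  qed
  from bij_betw_same_card[OF this] show ?thesis by (simp add: card_cartesian_product)
qed

section \<open>Coplanarity and vanishing determinants\<close>

text \<open>The rows of a singular matrix may span less than a plane, so a plane has to be
  constructed: a basis of their span is extended to a basis of the whole space, and one of the added
  vectors is dropped.\<close>

lemma coplanar_iff_det:
  fixes A :: "'a::field ^ 4 ^ 4"
  shows "(\<exists>H\<in>proj_planes. \<forall>i. A $ i \<in> H) \<longleftrightarrow> det A = 0"
proof -
  have sp: "det A \<noteq> 0 \<longleftrightarrow> vec.span (rows A) = UNIV"
    by (metis invertible_det_nz invertible_left_inverse matrix_left_invertible_span_rows_gen)
  have rows: "rows A = range (\<lambda>i. A $ i)" by (auto simp: rows_def row_def vec_nth_inverse)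
  show ?thesis
  proof
    assume "\<exists>H\<in>proj_planes. \<forall>i. A $ i \<in> H"
    then obtain H where H: "vec.subspace H" "vec.dim H = 3" "rows A \<subseteq> H"
      unfolding proj_planes_def rows by auto
    then have "vec.span (rows A) \<subseteq> H" by (simp add: vec.span_minimal)
    moreover have "H \<noteq> UNIV" using H(2) vec_dim_card[where 'a='a and 'n=4] by auto
    ultimately show "det A = 0" using sp by auto
  next
    assume "det A = 0"
    then have ne: "vec.span (rows A) \<noteq> UNIV" using sp by auto
    obtain B where B: "B \<subseteq> rows A" "vec.independent B" "rows A \<subseteq> vec.span B"
      using vec.maximal_independent_subset by blast
    then obtain C where C: "B \<subseteq> C" "vec.independent C" "UNIV \<subseteq> vec.span C"
      by (metis vec.maximal_independent_subset_extend subset_UNIV)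
    have "card C = 4" using vec.basis_card_eq_dim[of C UNIV] C vec_dim_card[where 'a='a and 'n=4] by simp
    then have finC: "finite C" using card.infinite by fastforce
    have "B \<noteq> C"
    proof
      assume "B = C"
      then have "vec.span (rows A) = UNIV" using C(3) vec.span_mono[OF B(1)] by auto
      with ne show False by simp
    qed
    then obtain c where c: "c \<in> C" "c \<notin> B" using C(1) by auto
    let ?H = "vec.span (C - {c})"
    have "vec.independent (C - {c})" using C(2) vec.independent_mono by blast
    then have "vec.dim ?H = 3" using vec.dim_span_eq_card_independent[of "C - {c}"] card_Diff_singleton[OF c(1)] \<open>card C = 4\<close> by simp
    moreover have "rows A \<subseteq> ?H" using B(3) vec.span_mono[of B "C - {c}"] c C(1) by blast
    ultimately show "\<exists>H\<in>proj_planes. \<forall>i. A $ i \<in> H"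
      unfolding proj_planes_def rows by (intro bexI[of _ ?H]) (auto simp: vec.subspace_span)
  qed
qed

section \<open>Independent lists and the order of the general linear group\<close>

lemma card_span_independent:
  fixes B :: "('a::{field,finite} ^ 'n) set"
  assumes "vec.independent B"
  shows "card (vec.span B) = CARD('a) ^ card B"
proof -
  have "finite B" by simp
  then show ?thesis using assms
  proof (induction B)
    case (insert b B)
    then have ind: "vec.independent B" "b \<notin> vec.span B"
      using vec.independent_insert[of b B] by auto
    let ?g = "\<lambda>(c, x). c *s b + x"
    have "inj_on ?g (UNIV \<times> vec.span B)"
    proof (rule inj_onI, clarify)
      fix c x c' x' assume x: "x \<in> vec.span B" "x' \<in> vec.span B" and eq: "c *s b + x = c' *s b + x'"
      have d: "(c - c') *s b = x' - x" using eq by (simp add: vec.scale_left_diff_distrib algebra_simps)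
      have "c = c'"
      proof (rule ccontr)
        assume "c \<noteq> c'"
        then have "b = inverse (c - c') *s (x' - x)" using d by (metis right_minus_eq vec.scale_scale vec.scale_one left_inverse)
        then have "b \<in> vec.span B" using x by (simp add: vec.span_diff vec.span_scale)
        with ind show False by simp
      qed
      with eq show "c = c' \<and> x = x'" by simp
    qed
    moreover have "?g ` (UNIV \<times> vec.span B) = vec.span (insert b B)"
    proof (intro equalityI subsetI)
      fix y assume "y \<in> ?g ` (UNIV \<times> vec.span B)"
      then obtain c x where "y = c *s b + x" "x \<in> vec.span B" by auto
      then show "y \<in> vec.span (insert b B)" 
        unfolding vec.span_insert by (auto intro!: exI[of _ c])
    next
      fix y assume "y \<in> vec.span (insert b B)"
      then obtain k where "y - k *s b \<in> vec.span B" by (auto simp: vec.span_insert)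
      then show "y \<in> ?g ` (UNIV \<times> vec.span B)" by (intro image_eqI[of _ _ "(k, y - k *s b)"]) auto
    qed
    ultimately have "card (vec.span (insert b B)) = CARD('a) * card (vec.span B)"
      by (metis (no_types) card_image card_cartesian_product)
    then show ?case using insert ind by simp
  qed simp
qed

text \<open>A new head has to avoid the span of the \<open>k\<close> vectors already present, which
  has \<open>CARD('a) ^ k\<close> elements.\<close>

lemma card_independent_lists:
  "card {vs :: ('a::{field,finite} ^ 'n) list. length vs = k \<and> distinct vs \<and> vec.independent (set vs)} =
    (\<Prod>i<k. CARD('a) ^ CARD('n) - CARD('a) ^ i)"
proof (induction k)
  case 0
  have "{vs :: ('a ^ 'n) list. length vs = 0 \<and> distinct vs \<and> vec.independent (set vs)} = {[]}"
    by (auto simp: vec.independent_empty)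
  then show ?case by simp
next
  case (Suc k)
  let ?I = "\<lambda>k. {vs :: ('a ^ 'n) list. length vs = k \<and> distinct vs \<and> vec.independent (set vs)}"
  have fin: "finite (?I k)"
    by (rule finite_subset[OF _ finite_lists_length_eq[of UNIV k]]) auto
  have "?I (Suc k) = (\<lambda>(vs, v). v # vs) ` (SIGMA vs : ?I k. - vec.span (set vs))"
  proof (intro equalityI subsetI)
    fix ws assume "ws \<in> ?I (Suc k)"
    then obtain v vs where ws: "ws = v # vs" "vs \<in> ?I k" "v \<notin> vec.span (set vs)"
    proof (cases ws)
      case (Cons v vs)
      then have "vec.independent (insert v (set vs))" "v \<notin> set vs" using \<open>ws \<in> ?I (Suc k)\<close> by auto
      then have "vec.independent (set vs) \<and> v \<notin> vec.span (set vs)" by (metis vec.independent_insert)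
      then show ?thesis using that Cons \<open>ws \<in> ?I (Suc k)\<close> by auto
    qed auto
    then show "ws \<in> (\<lambda>(vs, v). v # vs) ` (SIGMA vs : ?I k. - vec.span (set vs))" by force
  next
    fix ws assume "ws \<in> (\<lambda>(vs, v). v # vs) ` (SIGMA vs : ?I k. - vec.span (set vs))"
    then obtain v vs where ws: "ws = v # vs" "vs \<in> ?I k" "v \<notin> vec.span (set vs)" by auto
    then have "vec.independent (insert v (set vs))" by (intro vec.independent_insertI) auto
    with ws show "ws \<in> ?I (Suc k)" by (auto dest: vec.span_base)
  qed
  moreover have "inj_on (\<lambda>(vs, v). v # vs) (SIGMA vs : ?I k. - vec.span (set vs))"
    by (auto simp: inj_on_def)
  ultimately have "card (?I (Suc k)) = card (SIGMA vs : ?I k. - vec.span (set vs))"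
    by (simp add: card_image)
  also have "\<dots> = (\<Sum>vs\<in>?I k. card (- vec.span (set vs)))"
    using fin by (intro card_SigmaI) auto
  also have "\<dots> = (\<Sum>vs\<in>?I k. CARD('a) ^ CARD('n) - CARD('a) ^ k)"
  proof (rule sum.cong)
    fix vs assume "vs \<in> ?I k"
    then have "card (vec.span (set vs)) = CARD('a) ^ k"
      using card_span_independent[of "set vs"] distinct_card[of vs] by auto
    then show "card (- vec.span (set vs)) = CARD('a) ^ CARD('n) - CARD('a) ^ k"
      by (simp add: Compl_eq_Diff_UNIV card_Diff_subset)
  qed simp
  finally show ?case using Suc by simp
qed

text \<open>A square matrix is invertible iff its rows span, and as many spanning rows as the
  dimension are automatically distinct and independent. Reading off the rows along an enumeration of
  the index type thus leads to the lists of \<open>card_independent_lists\<close>.\<close>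

lemma card_det_nonzero:
  "card {M :: 'a::{field,finite} ^ 'n ^ 'n. det M \<noteq> 0} = (\<Prod>i<CARD('n). CARD('a) ^ CARD('n) - CARD('a) ^ i)"
proof -
  obtain es :: "'n list" where es: "distinct es" "set es = UNIV"
    by (metis finite_distinct_list finite)
  have len: "length es = CARD('n)" using es by (metis distinct_card)
  obtain f :: "'n \<Rightarrow> nat" where f: "\<And>i. f i < length es" "\<And>i. es ! f i = i"
    and fes: "\<And>j. j < length es \<Longrightarrow> f (es ! j) = j" and injf: "inj f"
    by (rule enumeration_index[OF es]) (rule that)
  let ?I = "{vs :: ('a ^ 'n) list. length vs = CARD('n) \<and> distinct vs \<and> vec.independent (set vs)}"
  have iff: "det M \<noteq> 0 \<longleftrightarrow> map (\<lambda>i. M $ i) es \<in> ?I" for M :: "'a ^ 'n ^ 'n"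
  proof -
    have sp: "det M \<noteq> 0 \<longleftrightarrow> vec.span (rows M) = UNIV"
      by (metis invertible_det_nz invertible_left_inverse matrix_left_invertible_span_rows_gen)
    have rows: "rows M = set (map (\<lambda>i. M $ i) es)" using es(2) by (auto simp: rows_def row_def vec_nth_inverse)
    have dim: "vec.dim (UNIV :: ('a ^ 'n) set) = CARD('n)" by (rule vec_dim_card)
    show ?thesis
    proof
      assume "det M \<noteq> 0"
      then have s: "UNIV \<subseteq> vec.span (rows M)" using sp by simp
      have c1: "CARD('n) \<le> card (rows M)"
        using vec.dim_le_card[OF s] dim by simp
      have c2: "card (rows M) \<le> length (map (\<lambda>i. M $ i) es)" unfolding rows by (rule card_length)
      have c: "card (rows M) = CARD('n)" using c1 c2 len by simp
      have "vec.independent (rows M)"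
        by (rule vec.card_le_dim_spanning[of _ UNIV]) (use s c dim in auto)
      moreover have "distinct (map (\<lambda>i. M $ i) es)" 
        using c len unfolding rows by (metis card_distinct length_map)
      ultimately show "map (\<lambda>i. M $ i) es \<in> ?I" using rows len by simp
    next
      assume m: "map (\<lambda>i. M $ i) es \<in> ?I"
      then have "card (rows M) = CARD('n)" unfolding rows using distinct_card by force
      then have "UNIV \<subseteq> vec.span (rows M)" 
        using vec.card_eq_dim[of "rows M" UNIV] dim m rows by simp
      then show "det M \<noteq> 0" using sp by auto
    qed
  qed
  have "bij_betw (\<lambda>M :: 'a ^ 'n ^ 'n. map (\<lambda>i. M $ i) es) {M. det M \<noteq> 0} ?I"
  proof (rule bij_betwI[where g = "\<lambda>vs. \<chi> i. vs ! f i"])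
    show "(\<lambda>M :: 'a ^ 'n ^ 'n. map (\<lambda>i. M $ i) es) \<in> {M. det M \<noteq> 0} \<rightarrow> ?I" using iff by blast
    have inv: "map (\<lambda>i. (\<chi> i. vs ! f i) $ i) es = vs" if "length vs = CARD('n)" for vs :: "('a ^ 'n) list"
      by (rule nth_equalityI) (use that len fes in auto)
    show "(\<lambda>vs. \<chi> i. vs ! f i) \<in> ?I \<rightarrow> {M :: 'a ^ 'n ^ 'n. det M \<noteq> 0}"
    proof
      fix vs assume vs: "vs \<in> ?I"
      then have "map (\<lambda>i. (\<chi> i. vs ! f i) $ i) es \<in> ?I" by (subst inv) auto
      then show "(\<chi> i. vs ! f i) \<in> {M :: 'a ^ 'n ^ 'n. det M \<noteq> 0}" using iff by blast
    qed
    show "(\<chi> i. map (\<lambda>i. M $ i) es ! f i) = M" for M :: "'a ^ 'n ^ 'n"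
      using f by (simp add: vec_eq_iff)
    show "map (\<lambda>i. (\<chi> i. vs ! f i) $ i) es = vs" if "vs \<in> ?I" for vs using that inv by blast
  qed
  from bij_betw_same_card[OF this] show ?thesis by (simp only: card_independent_lists)
qed

section \<open>Arcs and generic lists in dimension four\<close>

definition line_of :: "'a::field ^ 'n \<Rightarrow> ('a ^ 'n) set" where
  "line_of v = vec.span {v}"

lemma line_of_subset_iff: "vec.subspace H \<Longrightarrow> line_of v \<subseteq> H \<longleftrightarrow> v \<in> H"
  unfolding line_of_def by (meson insertI1 singletonI subset_iff vec.span_minimal vec.span_base empty_subsetI insert_subset)

lemma line_of_in_proj_points: "v \<noteq> 0 \<Longrightarrow> line_of v \<in> proj_points"
  using vec.dim_span_eq_card_independent[of "{v}"]
  by (simp add: line_of_def proj_points_def vec.subspace_span vec.independent_insert vec.independent_empty)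

lemma proj_point_is_line_of:
  assumes "P \<in> proj_points"
  shows "\<exists>v. v \<noteq> 0 \<and> line_of v = P"
proof -
  have P: "vec.subspace P" "vec.dim P = 1" using assms by (auto simp: proj_points_def)
  obtain B where B: "B \<subseteq> P" "vec.independent B" "P \<subseteq> vec.span B" "card B = vec.dim P"
    using vec.basis_exists by blast
  with P obtain v where v: "B = {v}" by (metis card_1_singletonE)
  have "vec.span B = P" using B P by (metis subset_antisym vec.span_minimal)
  moreover have "v \<noteq> 0" using B(2) v vec.dependent_zero by auto
  ultimately show ?thesis using v by (intro exI[of _ v]) (simp add: line_of_def)
qed

lemma in_line_of_iff: "w \<in> line_of v \<longleftrightarrow> (\<exists>c. w = c *s v)"
  by (auto simp: line_of_def vec.span_singleton)

lemma line_of_scale: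
  assumes "c \<noteq> 0"
  shows "line_of (c *s v) = line_of v"
proof (rule Set.set_eqI)
  fix w
  have "d *s v = (d / c) *s (c *s v)" for d using assms by simp
  then show "w \<in> line_of (c *s v) \<longleftrightarrow> w \<in> line_of v"
    unfolding in_line_of_iff by (metis vec.scale_scale)
qed

text \<open>\<open>rows A\<close> is a set, in which equal rows collapse, so that their dependence
  is no longer visible. That case is left to the rule for identical rows; otherwise
  \<open>A $ i\<close> lies in the span of the other rows.\<close>

lemma det_proportional_rows:
  fixes A :: "'a::field ^ 'n ^ 'n"
  assumes "i \<noteq> j" "A $ i = c *s A $ j"
  shows "det A = 0"
proof (cases "A $ i = A $ j")
  case True
  with assms show ?thesis using det_identical_rows[of i j A] by (simp add: row_def vec_nth_inverse)
next
  case False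
  have rows: "rows A = range (\<lambda>i. A $ i)" by (auto simp: rows_def row_def vec_nth_inverse)
  have "A $ j \<in> rows A - {A $ i}" using False rows by auto
  then have "c *s A $ j \<in> vec.span (rows A - {A $ i})" by (simp add: vec.span_base vec.span_scale)
  then have "vec.dependent (rows A)" unfolding vec.dependent_def rows using assms by (metis rangeI)
  then show ?thesis by (rule det_dependent_rows)
qed

text \<open>For fewer than four entries genericity would be vacuous. With \<open>n \<ge> 4\<close>
  it also rules out zero vectors and repeated points, because each of these defects already makes
  some selection of four entries singular.\<close>

lemma generic_iff_ordered_arc:
  fixes vs :: "('a::field ^ 4) list"
  assumes n: "length vs = n" "n \<ge> 4"
  shows "generic vs \<longleftrightarrow> (\<forall>v\<in>set vs. v \<noteq> 0) \<and> map line_of vs \<in> ordered_arcs n"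
proof
  assume g: "generic vs"
  have det: "det (\<chi> i. vs ! f i) \<noteq> 0" if "inj f" "range f \<subseteq> {..<n}" for f
    using g that n(1) by (auto simp: generic_def)
  \<comment> \<open>Any one or two positions can be completed to four, which turns a defect at these
    positions into a vanishing determinant.\<close>
  have ex: "\<exists>f :: 4 \<Rightarrow> nat. inj f \<and> range f \<subseteq> {..<n} \<and> j \<in> range f \<and> k \<in> range f"
    if "j < n" "k < n" for j k
  proof -
    have "card {j, k} \<le> 4" by (simp add: card_insert_if)
    then have "\<exists>S. {j, k} \<subseteq> S \<and> S \<subseteq> {..<n} \<and> card S = 4"
      by (intro exists_subset_between) (use n that in auto)
    then obtain S where S: "{j, k} \<subseteq> S" "S \<subseteq> {..<n}" "card S = 4" by blast
    then have "finite S" using finite_subset by blast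
    then obtain f where "bij_betw f (UNIV :: 4 set) S"
      using S(3) finite_same_card_bij[of "UNIV :: 4 set" S] by auto
    then show ?thesis using S unfolding bij_betw_def by blast
  qed
  have nz: "vs ! j \<noteq> 0" if j: "j < n" for j
  proof
    assume z: "vs ! j = 0"
    obtain f :: "4 \<Rightarrow> nat" and i where f: "inj f" "range f \<subseteq> {..<n}" "f i = j" using ex[OF j j] by auto
    have "det (\<chi> i. vs ! f i) = 0"
      using f z by (intro det_zero_row(2)[of i]) (simp add: row_def vec_eq_iff)
    with det f show False by blast
  qed
  have dist: "line_of (vs ! j) \<noteq> line_of (vs ! k)" if jk: "j < n" "k < n" "j \<noteq> k" for j k
  proof
    assume eq: "line_of (vs ! j) = line_of (vs ! k)"
    obtain f :: "4 \<Rightarrow> nat" and i i' where f: "inj f" "range f \<subseteq> {..<n}" "f i = j" "f i' = k"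
      using ex[OF jk(1,2)] by auto
    have "vs ! j \<in> line_of (vs ! k)" unfolding eq[symmetric] in_line_of_iff by (rule exI[of _ 1]) simp
    then obtain c where "vs ! j = c *s vs ! k" by (auto simp: in_line_of_iff)
    then have "det (\<chi> i. vs ! f i) = 0"
      using f jk by (intro det_proportional_rows[of i i' _ c]) auto
    with det f show False by blast
  qed
  have distinct: "distinct (map line_of vs)" using dist n by (simp add: distinct_conv_nth)
  have "\<not> coplanar_points T" if T: "T \<subseteq> set (map line_of vs)" "card T = 4" for T
  proof
    assume "coplanar_points T"
    then obtain H where H: "H \<in> proj_planes" "\<And>P. P \<in> T \<Longrightarrow> P \<subseteq> H" by (auto simp: coplanar_points_def)
    have "finite T" using T(1) finite_subset by blast
    then obtain f where f: "bij_betw f (UNIV :: 4 set) T"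
      using T(2) finite_same_card_bij[of "UNIV :: 4 set" T] by auto
    have "\<forall>i. \<exists>j<n. f i = line_of (vs ! j)"
      using f T(1) n(1) unfolding bij_betw_def by (metis in_set_conv_nth length_map nth_map rangeI subsetD)
    then obtain h where h: "\<And>i. h i < n" "\<And>i. f i = line_of (vs ! h i)" by metis
    have "inj h" using f h(2) by (metis bij_betw_def injD injI)
    then have "det (\<chi> i. vs ! h i) \<noteq> 0" using det h(1) by auto
    moreover have "vs ! h i \<in> H" for i
      using H f h(2)[of i] line_of_subset_iff[of H "vs ! h i"] unfolding bij_betw_def proj_planes_def by auto
    then have "det (\<chi> i. vs ! h i) = 0" using H(1) by (intro iffD1[OF coplanar_iff_det] bexI[of _ H]) auto
    ultimately show False by simp
  qed
  moreover have nz': "\<forall>v\<in>set vs. v \<noteq> 0" using nz n(1) by (metis in_set_conv_nth)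
  moreover have "card (set (map line_of vs)) = n" using distinct_card[OF distinct] n by simp
  moreover have "set (map line_of vs) \<subseteq> proj_points" using nz' by (auto simp: line_of_in_proj_points)
  ultimately show "(\<forall>v\<in>set vs. v \<noteq> 0) \<and> map line_of vs \<in> ordered_arcs n"
    using distinct n(1) unfolding ordered_arcs_def is_arc_def mem_Collect_eq length_map
    by (intro conjI) (assumption | rule finite_set | blast)+
next
  assume a: "(\<forall>v\<in>set vs. v \<noteq> 0) \<and> map line_of vs \<in> ordered_arcs n"
  then have dist: "distinct (map line_of vs)"
    and arc: "\<And>T. T \<subseteq> set (map line_of vs) \<Longrightarrow> card T = 4 \<Longrightarrow> \<not> coplanar_points T"
    unfolding ordered_arcs_def is_arc_def by blast+
  show "generic vs" unfolding generic_def
  proof (intro allI impI notI)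
    fix f :: "4 \<Rightarrow> nat" assume f: "inj f" "range f \<subseteq> {..<length vs}" and det: "det (\<chi> i. vs ! f i) = 0"
    then have fl: "f i < length vs" for i by auto
    obtain H where H: "H \<in> proj_planes" "\<And>i. vs ! f i \<in> H"
      using det unfolding coplanar_iff_det[symmetric] by auto
    let ?T = "range (\<lambda>i. line_of (vs ! f i))"
    have "inj (\<lambda>i. line_of (vs ! f i))"
    proof (rule injI)
      fix i j assume "line_of (vs ! f i) = line_of (vs ! f j)"
      then have "map line_of vs ! f i = map line_of vs ! f j" using fl by simp
      then have "f i = f j" using dist fl by (simp only: nth_eq_iff_index_eq length_map)
      then show "i = j" using f(1) by (simp add: inj_eq)
    qed
    then have "card ?T = 4" by (simp add: card_image)
    moreover have "?T \<subseteq> set (map line_of vs)" using fl by auto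
    moreover have "coplanar_points ?T"
      unfolding coplanar_points_def using H line_of_subset_iff
      by (intro bexI[of _ H]) (auto simp: proj_planes_def)
    ultimately show False using arc by blast
  qed
qed

lemma ordered_arcsD:
  assumes "ps \<in> ordered_arcs n"
  shows "length ps = n" "\<And>i. i < n \<Longrightarrow> ps ! i \<in> proj_points"
  using assms unfolding ordered_arcs_def is_arc_def by (auto dest: nth_mem)

text \<open>Once a representative \<open>r P\<close> is chosen for every point, a generic list is
  the same as an ordered arc together with one nonzero scalar for each of its points.\<close>

lemma card_generic_eq_num_ordered_arcs:
  assumes n: "n \<ge> 4"
  shows "card {vs :: ('a::{field,finite} ^ 4) list. length vs = n \<and> generic vs} =
    (CARD('a) - 1) ^ n * num_ordered_arcs TYPE('a) n"
proof -
  let ?S = "{cs :: 'a list. set cs \<subseteq> UNIV - {0} \<and> length cs = n}"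
  let ?O = "ordered_arcs n :: ('a ^ 4) set list set"
  let ?G = "{vs :: ('a ^ 4) list. length vs = n \<and> generic vs}"
  have "\<forall>P\<in>proj_points. \<exists>v :: 'a ^ 4. v \<noteq> 0 \<and> line_of v = P"
    by (intro ballI proj_point_is_line_of)
  then obtain r :: "('a ^ 4) set \<Rightarrow> 'a ^ 4" where r: "\<And>P. P \<in> proj_points \<Longrightarrow> r P \<noteq> 0 \<and> line_of (r P) = P"
    by (drule_tac bchoice) blast
  let ?h = "\<lambda>(cs, ps). map (\<lambda>(c, P). c *s r P) (zip cs ps)"
  have hp: "map line_of (?h (cs, ps)) = ps" "\<And>v. v \<in> set (?h (cs, ps)) \<Longrightarrow> v \<noteq> 0"
    if "cs \<in> ?S" "ps \<in> ?O" for cs ps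
  proof -
    have l: "length cs = n" "length ps = n" and c: "\<And>i. i < n \<Longrightarrow> cs ! i \<noteq> 0"
      and p: "\<And>i. i < n \<Longrightarrow> ps ! i \<in> proj_points"
      using that ordered_arcsD[OF that(2)] by (simp_all add: in_set_conv_nth subset_iff) metis+
    show "map line_of (?h (cs, ps)) = ps"
      by (rule nth_equalityI) (simp_all add: l c p r line_of_scale)
    show "v \<noteq> 0" if "v \<in> set (?h (cs, ps))" for v
    proof -
      have "v \<in> (\<lambda>(c, P). c *s r P) ` set (zip cs ps)" using that by simp
      then obtain i where "i < n" "v = cs ! i *s r (ps ! i)" using l by (auto simp: set_zip)
      then show ?thesis using c r p by simp
    qed
  qed
  have "bij_betw ?h (?S \<times> ?O) ?G"
    unfolding bij_betw_def
  proof
    show "inj_on ?h (?S \<times> ?O)"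
    proof (rule inj_onI)
      fix x y assume x: "x \<in> ?S \<times> ?O" and y: "y \<in> ?S \<times> ?O" and eq: "?h x = ?h y"
      obtain cs ps cs' ps' where xy: "x = (cs, ps)" "y = (cs', ps')" by (metis surj_pair)
      have "map line_of (?h x) = ps" "map line_of (?h y) = ps'"
        unfolding xy by (rule hp(1); use x y xy in blast)+
      then have ps: "ps = ps'" unfolding eq by simp
      have l: "length cs = n" "length cs' = n" "length ps = n" 
        and p: "\<And>i. i < n \<Longrightarrow> ps ! i \<in> proj_points"
        using x y xy ordered_arcsD[of ps n] by auto
      have "cs = cs'"
      proof (rule nth_equalityI)
        fix i assume i: "i < length cs"
        then have "?h x ! i = ?h y ! i" using eq by simp
        then have "cs ! i *s r (ps ! i) = cs' ! i *s r (ps ! i)" using i l ps xy by simp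
        then show "cs ! i = cs' ! i" using r p i l by (simp add: vec.scale_right_imp_eq)
      qed (use l in simp)
      with ps xy show "x = y" by simp
    qed
    show "?h ` (?S \<times> ?O) = ?G"
    proof (intro equalityI subsetI)
      fix vs assume "vs \<in> ?h ` (?S \<times> ?O)"
      then obtain cs ps where c: "cs \<in> ?S" "ps \<in> ?O" and vs: "vs = ?h (cs, ps)" by blast
      have l: "length vs = n" using c ordered_arcsD(1)[OF c(2)] unfolding vs by simp
      have "map line_of vs \<in> ?O" unfolding vs hp(1)[OF c] by (rule c(2))
      moreover have "\<forall>v\<in>set vs. v \<noteq> 0" unfolding vs using hp(2)[OF c] by blast
      ultimately have "generic vs" by (intro iffD2[OF generic_iff_ordered_arc[OF l n]] conjI)
      with l show "vs \<in> ?G" by simp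
    next
      fix vs assume vs: "vs \<in> ?G"
      then have l: "length vs = n" and nz: "\<And>v. v \<in> set vs \<Longrightarrow> v \<noteq> 0" and arc: "map line_of vs \<in> ?O"
        using generic_iff_ordered_arc[of vs n] n by auto
      have "\<exists>c. c \<noteq> 0 \<and> v = c *s r (line_of v)" if "v \<in> set vs" for v
      proof -
        have "line_of (r (line_of v)) = line_of v" using r line_of_in_proj_points nz that by blast
        moreover have "v \<in> line_of v" unfolding in_line_of_iff by (rule exI[of _ 1]) simp
        ultimately obtain c where "v = c *s r (line_of v)" using in_line_of_iff by metis
        moreover then have "c \<noteq> 0" using nz[OF that] by auto
        ultimately show ?thesis by blast
      qed
      then obtain c where c: "\<And>v. v \<in> set vs \<Longrightarrow> c v \<noteq> 0 \<and> v = c v *s r (line_of v)" by metis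
      have e: "?h (map c vs, map line_of vs) = vs"
        using c by (auto simp: zip_map_map zip_same_conv_map intro!: map_idI)
      have "(map c vs, map line_of vs) \<in> ?S \<times> ?O" using c l arc by auto
      then have "?h (map c vs, map line_of vs) \<in> ?h ` (?S \<times> ?O)" by (rule imageI)
      then show "vs \<in> ?h ` (?S \<times> ?O)" unfolding e .
    qed
  qed
  from bij_betw_same_card[OF this] show ?thesis
    by (simp add: card_cartesian_product card_lists_length_eq card_Diff_subset num_ordered_arcs_def)
qed

section \<open>Extending a six-arc in the plane\<close>

definition det3 :: "'a::field ^ 3 \<Rightarrow> 'a ^ 3 \<Rightarrow> 'a ^ 3 \<Rightarrow> 'a" where
  "det3 u v w = det (\<chi> i. if i = 1 then u else if i = 2 then v else w)"

lemma det3_eq: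
  "det3 u v w = u$1 * v$2 * w$3 + u$2 * v$3 * w$1 + u$3 * v$1 * w$2
     - u$1 * v$3 * w$2 - u$2 * v$1 * w$3 - u$3 * v$2 * w$1"
  by (simp add: det3_def det_3)

lemma generic_3_iff:
  "generic (vs :: ('a::field ^ 3) list) \<longleftrightarrow>
    (\<forall>i<length vs. \<forall>j<length vs. \<forall>k<length vs. i \<noteq> j \<longrightarrow> i \<noteq> k \<longrightarrow> j \<noteq> k \<longrightarrow> det3 (vs ! i) (vs ! j) (vs ! k) \<noteq> 0)"
    (is "_ = ?R")
proof
  assume g: "generic vs"
  show ?R
  proof (intro allI impI)
    fix i j k assume l: "i < length vs" "j < length vs" "k < length vs" and d: "i \<noteq> j" "i \<noteq> k" "j \<noteq> k"
    let ?f = "\<lambda>x :: 3. if x = 1 then i else if x = 2 then j else k"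
    have "inj ?f" using d exhaust_3 by (auto simp: inj_def)
    moreover have "range ?f \<subseteq> {..<length vs}" using l by auto
    ultimately have "det (\<chi> x. vs ! ?f x) \<noteq> 0" using g unfolding generic_def by blast
    moreover have "(\<chi> x. vs ! ?f x) = (\<chi> x. if x = 1 then vs ! i else if x = 2 then vs ! j else vs ! k)"
      by (simp add: vec_eq_iff)
    ultimately show "det3 (vs ! i) (vs ! j) (vs ! k) \<noteq> 0" by (simp add: det3_def)
  qed
next
  assume R: ?R
  show "generic vs" unfolding generic_def
  proof (intro allI impI)
    fix f :: "3 \<Rightarrow> nat" assume f: "inj f" "range f \<subseteq> {..<length vs}"
    have d: "f 1 \<noteq> f 2" "f 1 \<noteq> f 3" "f 2 \<noteq> f 3" using f(1) by (auto simp: inj_eq)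
    have "f x < length vs" for x using f(2) by auto
    then have "det3 (vs ! f 1) (vs ! f 2) (vs ! f 3) \<noteq> 0" using R d by blast
    then show "det (\<chi> x. vs ! f x) \<noteq> 0" by (simp add: det3_eq det_3)
  qed
qed

lemma det3_combination:
  "det3 (x *s u + y *s u') v w = x * det3 u v w + y * det3 u' v w"
  "det3 u (x *s v + y *s v') w = x * det3 u v w + y * det3 u v' w"
  "det3 u v (x *s w + y *s w') = x * det3 u v w + y * det3 u v w'"
  by (simp_all add: det3_eq algebra_simps)

lemma det3_scale:
  "det3 (x *s u) v w = x * det3 u v w"
  "det3 u (x *s v) w = x * det3 u v w"
  "det3 u v (x *s w) = x * det3 u v w"
  by (simp_all add: det3_eq algebra_simps)

lemma det3_repeat [simp]: "det3 u u w = 0" "det3 u v u = 0" "det3 u v v = 0"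
  by (simp_all add: det3_eq)

lemma det3_zero [simp]: "det3 0 v w = 0" "det3 u 0 w = 0" "det3 u v 0 = 0"
  by (simp_all add: det3_eq)

lemma det3_rotate: "det3 v w u = det3 u v w"
  by (simp add: det3_eq algebra_simps)

lemma det3_swap: "det3 v u w = - det3 u v w"
  by (simp add: det3_eq algebra_simps)

lemma det3_cramer: "det3 u v w *s x = det3 x v w *s u + det3 u x w *s v + det3 u v x *s w"
  by (simp add: vec_eq_iff forall_3 det3_eq algebra_simps)

text \<open>In Cramer's rule the coefficient of \<open>w\<close> is \<open>det3 u v x\<close>. When
  it vanishes, \<open>x\<close> is left as a combination of \<open>u\<close> and
  \<open>v\<close>.\<close>

lemma det3_eq_0D:
  assumes "det3 u v w \<noteq> 0" "det3 u v x = 0"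
  obtains a b where "x = a *s u + b *s v"
proof
  have "det3 u v w *s x = det3 x v w *s u + det3 u x w *s v"
    using det3_cramer[of u v w x] assms(2) by simp
  then have "inverse (det3 u v w) *s (det3 u v w *s x) =
    inverse (det3 u v w) *s (det3 x v w *s u + det3 u x w *s v)" by simp
  then show "x = (inverse (det3 u v w) * det3 x v w) *s u + (inverse (det3 u v w) * det3 u x w) *s v"
    using assms(1) by (simp add: vec.scale_right_distrib)
qed

text \<open>
  The vector \<open>det3 a b d *s c - det3 a b c *s d\<close> spans the intersection of the planes \<open>\<langle>a, b\<rangle>\<close> and \<open>\<langle>c, d\<rangle>\<close>;
  it lies on \<open>\<langle>e, f\<rangle>\<close> iff the following equation holds.
\<close>

definition concurrent :: "(nat \<Rightarrow> 'a::field ^ 3) \<Rightarrow> bool" where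
  "concurrent p \<longleftrightarrow> det3 (p 0) (p 1) (p 3) * det3 (p 4) (p 5) (p 2) = det3 (p 0) (p 1) (p 2) * det3 (p 4) (p 5) (p 3)"

section \<open>Vectors off a six-arc and the lines through its points\<close>

locale six_arc =
  fixes p :: "nat \<Rightarrow> 'a::{field,finite} ^ 3"
  assumes arc: "\<lbrakk>i < 6; j < 6; k < 6; i \<noteq> j; i \<noteq> k; j \<noteq> k\<rbrakk> \<Longrightarrow> det3 (p i) (p j) (p k) \<noteq> 0"
begin

text \<open>The choice \<open>c = 0\<close> excludes the zero vector as well, so these are exactly
  the representatives of the points outside the arc.\<close>

definition off :: "('a ^ 3) set" where
  "off = {v. \<forall>i<6. \<forall>c. v \<noteq> c *s p i}"

abbreviation on :: "nat \<Rightarrow> nat \<Rightarrow> 'a ^ 3 \<Rightarrow> bool" where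
  "on i j v \<equiv> det3 (p i) (p j) v = 0"

lemma exists_other_index: "\<exists>k<6. k \<noteq> i \<and> k \<noteq> j" for i j :: nat
  by presburger

lemma point_nonzero: "i < 6 \<Longrightarrow> p i \<noteq> 0"
proof
  assume i: "i < 6" and z: "p i = 0"
  obtain j where j: "j < 6" "j \<noteq> i" using exists_other_index by blast
  obtain k where k: "k < 6" "k \<noteq> i" "k \<noteq> j" using exists_other_index by blast
  have "det3 (p i) (p j) (p k) \<noteq> 0" using arc i j k by simp
  then show False unfolding z by simp
qed

text \<open>If the vector were a multiple of an arc vector, a suitable determinant with two arc
  vectors would vanish, although expanding it gives \<open>a\<close> or \<open>b\<close> times a
  determinant of three distinct arc vectors.\<close>

lemma combination_off:
  assumes ij: "i < 6" "j < 6" "i \<noteq> j" and ab: "a \<noteq> 0" "b \<noteq> 0"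
  shows "a *s p i + b *s p j \<in> off"
  unfolding off_def
proof (intro CollectI allI impI notI)
  fix k c assume k: "k < 6" and eq: "a *s p i + b *s p j = c *s p k"
  obtain l where l: "l < 6" "l \<noteq> i" "l \<noteq> j" using exists_other_index by blast
  consider "k = i" | "k = j" | "k \<noteq> i" "k \<noteq> j" by blast
  then show False
  proof cases
    case 1
    have "b * det3 (p i) (p j) (p l) = det3 (p i) (a *s p i + b *s p j) (p l)" by (simp add: det3_combination)
    also have "\<dots> = 0" unfolding eq 1 by (simp add: det3_scale)
    finally show False using ab ij l arc by simp
  next
    case 2
    have "a * det3 (p i) (p j) (p l) = det3 (a *s p i + b *s p j) (p j) (p l)" by (simp add: det3_combination)
    also have "\<dots> = 0" unfolding eq 2 by (simp add: det3_scale)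
    finally show False using ab ij l arc by simp
  next
    case 3
    have "a * det3 (p i) (p j) (p k) = det3 (a *s p i + b *s p j) (p j) (p k)" by (simp add: det3_combination)
    also have "\<dots> = 0" unfolding eq by (simp add: det3_scale)
    finally show False using ab ij k 3 arc by simp
  qed
qed

lemma on_offE:
  assumes ij: "i < 6" "j < 6" "i \<noteq> j" and v: "v \<in> off" "on i j v"
  obtains a b where "a \<noteq> 0" "b \<noteq> 0" "v = a *s p i + b *s p j"
proof -
  obtain l where l: "l < 6" "l \<noteq> i" "l \<noteq> j" using exists_other_index by blast
  obtain a b where ab: "v = a *s p i + b *s p j"
    using det3_eq_0D[of "p i" "p j" "p l" v] arc ij l v(2) by metis
  have "a \<noteq> 0" using v(1) ij ab unfolding off_def by auto
  moreover have "b \<noteq> 0" using v(1) ij ab unfolding off_def by auto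
  ultimately show ?thesis using that ab by blast
qed

lemma on_disjoint:
  assumes "i < 6" "j < 6" "k < 6" "i \<noteq> j" "i \<noteq> k" "j \<noteq> k" "v \<in> off" "on i j v"
  shows "\<not> on i k v"
proof
  assume "on i k v"
  obtain a b where ab: "a \<noteq> 0" "b \<noteq> 0" "v = a *s p i + b *s p j"
    using on_offE[of i j v] assms by blast
  have "det3 (p i) (p k) v = b * det3 (p i) (p k) (p j)" unfolding ab(3) by (simp add: det3_combination)
  then show False using \<open>on i k v\<close> ab arc assms by simp
qed

lemma combination_eq_iff:
  assumes ij: "i < 6" "j < 6" "i \<noteq> j"
  shows "a *s p i + b *s p j = a' *s p i + b' *s p j \<longleftrightarrow> a = a' \<and> b = b'"
proof (intro iffI conjI)
  assume eq: "a *s p i + b *s p j = a' *s p i + b' *s p j"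
  obtain l where l: "l < 6" "l \<noteq> i" "l \<noteq> j" using exists_other_index by blast
  have d: "det3 (p i) (p j) (p l) \<noteq> 0" using arc ij l by simp
  have "det3 (a *s p i + b *s p j) (p j) (p l) = det3 (a' *s p i + b' *s p j) (p j) (p l)"
    "det3 (p i) (a *s p i + b *s p j) (p l) = det3 (p i) (a' *s p i + b' *s p j) (p l)"
    unfolding eq by simp_all
  then show "a = a'" "b = b'" using d unfolding det3_combination by simp_all
qed simp

lemma card_on_one:
  assumes ij: "i < 6" "j < 6" "i \<noteq> j"
  shows "card {v \<in> off. on i j v} = (CARD('a) - 1) ^ 2"
proof -
  let ?g = "\<lambda>(a, b). a *s p i + b *s p j"
  have "{v \<in> off. on i j v} = ?g ` ((UNIV - {0}) \<times> (UNIV - {0}))"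
  proof (intro equalityI subsetI)
    fix v assume "v \<in> {v \<in> off. on i j v}"
    then obtain a b where "a \<noteq> 0" "b \<noteq> 0" "v = a *s p i + b *s p j"
      using on_offE[OF ij] by blast
    then show "v \<in> ?g ` ((UNIV - {0}) \<times> (UNIV - {0}))" by (intro image_eqI[of _ _ "(a, b)"]) auto
  next
    fix v assume "v \<in> ?g ` ((UNIV - {0}) \<times> (UNIV - {0}))"
    then obtain a b where "a \<noteq> 0" "b \<noteq> 0" and v: "v = a *s p i + b *s p j" by auto
    then show "v \<in> {v \<in> off. on i j v}" using combination_off[OF ij] by (simp add: v det3_combination)
  qed
  moreover have "inj_on ?g ((UNIV - {0}) \<times> (UNIV - {0}))"
    by (rule inj_onI) (auto simp: combination_eq_iff[OF ij])
  ultimately show ?thesis by (simp add: card_image card_cartesian_product power2_eq_square card_Diff_subset)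
qed

text \<open>The spanning vector of the intersection of two lines described before
  \<open>concurrent\<close>. The difference is written as a sum with a negated scalar, the form to
  which \<open>det3_combination\<close> applies.\<close>

definition meet :: "nat \<Rightarrow> nat \<Rightarrow> nat \<Rightarrow> nat \<Rightarrow> 'a ^ 3" where
  "meet i j k l = det3 (p i) (p j) (p l) *s p k + (- det3 (p i) (p j) (p k)) *s p l"

lemma on_two_eq:
  assumes ijkl: "i < 6" "j < 6" "k < 6" "l < 6" "distinct [i, j, k, l]"
  shows "{v \<in> off. on i j v \<and> on k l v} = (\<lambda>c. c *s meet i j k l) ` (UNIV - {0})"
proof (intro equalityI subsetI)
  let ?x = "det3 (p i) (p j) (p k)" and ?y = "det3 (p i) (p j) (p l)"
  have xy: "?x \<noteq> 0" "?y \<noteq> 0" using arc ijkl by auto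
  fix v
  {
    assume v: "v \<in> {v \<in> off. on i j v \<and> on k l v}"
    then obtain a b where ab: "a \<noteq> 0" "b \<noteq> 0" "v = a *s p k + b *s p l"
      using on_offE[of k l v] ijkl by auto
    have "a * ?x + b * ?y = 0" using v unfolding ab(3) by (simp add: det3_combination)
    then have a: "a = - (b * ?y / ?x)" using xy by (simp add: field_simps eq_neg_iff_add_eq_0)
    have "v = (- (b / ?x)) *s meet i j k l"
      using xy unfolding ab(3) a meet_def by (simp add: vec.scale_right_distrib vec_eq_iff field_simps)
    moreover have "- (b / ?x) \<noteq> 0" using ab xy by simp
    ultimately show "v \<in> (\<lambda>c. c *s meet i j k l) ` (UNIV - {0})" by blast
  next
    assume "v \<in> (\<lambda>c. c *s meet i j k l) ` (UNIV - {0})"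
    then obtain c where c: "c \<noteq> 0" "v = c *s meet i j k l" by auto
    have v: "v = (c * ?y) *s p k + (c * - ?x) *s p l"
      unfolding c(2) meet_def by (simp add: vec.scale_right_distrib)
    have "v \<in> off" unfolding v by (rule combination_off) (use ijkl xy c in auto)
    moreover have "on i j v" "on k l v" unfolding v det3_combination by simp_all
    ultimately show "v \<in> {v \<in> off. on i j v \<and> on k l v}" by simp
  }
qed

lemma meet_nonzero:
  assumes ijkl: "i < 6" "j < 6" "k < 6" "l < 6" "distinct [i, j, k, l]"
  shows "meet i j k l \<noteq> 0"
proof
  assume "meet i j k l = 0"
  then have "1 *s 0 \<in> {v \<in> off. on i j v \<and> on k l v}" unfolding on_two_eq[OF assms] by (intro image_eqI[of _ _ 1]) auto
  then have "0 \<in> off" by simp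
  then have "\<forall>i<6. \<forall>c. 0 \<noteq> c *s p i" unfolding off_def by blast
  then have "0 \<noteq> 0 *s p 0" using zero_less_numeral by blast
  then show False by simp
qed

lemma card_on_two:
  assumes ijkl: "i < 6" "j < 6" "k < 6" "l < 6" "distinct [i, j, k, l]"
  shows "card {v \<in> off. on i j v \<and> on k l v} = CARD('a) - 1"
  unfolding on_two_eq[OF assms]
  using meet_nonzero[OF assms] by (subst card_image) (auto simp: inj_on_def card_Diff_subset)

text \<open>Two disjoint lines meet in the nonzero multiples of a single vector, so the third line
  contains either all of them or none.\<close>

lemma card_on_three:
  assumes ijkl: "i < 6" "j < 6" "k < 6" "l < 6" "distinct [i, j, k, l]"
  shows "card {v \<in> off. on i j v \<and> on k l v \<and> on m n v} =
    (if concurrent ((!) (map p [i, j, k, l, m, n])) then CARD('a) - 1 else 0)"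
proof -
  have iff: "on m n (c *s meet i j k l) \<longleftrightarrow> concurrent ((!) (map p [i, j, k, l, m, n]))" if "c \<noteq> 0" for c
    using that by (simp add: det3_scale meet_def det3_combination concurrent_def del: vec.scale_minus_left)
  have "{v \<in> off. on i j v \<and> on k l v \<and> on m n v} = {v \<in> {v \<in> off. on i j v \<and> on k l v}. on m n v}" by auto
  also have "\<dots> = (if concurrent ((!) (map p [i, j, k, l, m, n])) then {v \<in> off. on i j v \<and> on k l v} else {})"
    unfolding on_two_eq[OF assms] using iff by auto
  finally show ?thesis using card_on_two[OF assms] by simp
qed

text \<open>The excluded vectors are zero and the q - 1 nonzero multiples of each of the six arc
  vectors; no two of these are proportional, so nothing is counted twice.\<close>

lemma card_off: "int (card off) = int CARD('a) ^ 3 - 1 - 6 * (int CARD('a) - 1)"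
proof -
  let ?L = "\<lambda>i. (\<lambda>c. c *s p i) ` (UNIV - {0})"
  have eq: "- off = insert 0 (\<Union>i\<in>{..<6}. ?L i)"
  proof (intro equalityI subsetI)
    fix v assume "v \<in> - off"
    then obtain i c where "i < 6" "v = c *s p i" by (auto simp: off_def)
    then show "v \<in> insert 0 (\<Union>i\<in>{..<6}. ?L i)" by (cases "c = 0") auto
  next
    fix v assume "v \<in> insert 0 (\<Union>i\<in>{..<6}. ?L i)"
    moreover have "0 = 0 *s p 0" by simp
    ultimately show "v \<in> - off" by (force simp: off_def)
  qed
  have inj: "inj_on (\<lambda>c. c *s p i) (UNIV - {0})" if "i < 6" for i
    using point_nonzero[OF that] by (auto simp: inj_on_def)
  have disj: "?L i \<inter> ?L j = {}" if "i \<in> {..<6}" "j \<in> {..<6}" "i \<noteq> j" for i j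
  proof -
    have "c *s p i \<noteq> c' *s p j" if "c \<noteq> 0" for c c'
      using combination_eq_iff[of i j c 0 0 c'] that \<open>i \<in> {..<6}\<close> \<open>j \<in> {..<6}\<close> \<open>i \<noteq> j\<close> by auto
    then show ?thesis by blast
  qed
  have "card (\<Union>i\<in>{..<6}. ?L i) = (\<Sum>i<6. card (?L i))"
    by (rule card_UN_disjoint) (use disj in auto)
  also have "\<dots> = 6 * (CARD('a) - 1)"
    using inj by (simp add: card_image card_Diff_subset)
  finally have "card (\<Union>i\<in>{..<6}. ?L i) = 6 * (CARD('a) - 1)" .
  moreover have "0 \<notin> (\<Union>i\<in>{..<6}. ?L i)" using point_nonzero by auto
  ultimately have "card (- off) = 1 + 6 * (CARD('a) - 1)" unfolding eq by simp
  moreover have "card off + card (- off) = CARD('a) ^ 3"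
    using card_Un_disjoint[of off "- off"] by simp
  moreover have "CARD('a) \<ge> 1" by (simp add: Suc_leI)
  ultimately have "card off + 1 + 6 * CARD('a) = CARD('a) ^ 3 + 6" by linarith
  then have "int (card off + 1 + 6 * CARD('a)) = int (CARD('a) ^ 3 + 6)" by (simp only:)
  then show ?thesis by simp
qed

end

section \<open>Matchings of the complete graph on six vertices\<close>

definition lines6 :: "(nat \<times> nat) list" where
  "lines6 = [(i, j). i \<leftarrow> [0..<6], j \<leftarrow> [i+1..<6]]"

lemma lines6_iff: "(i, j) \<in> set lines6 \<longleftrightarrow> i < j \<and> j < 6"
  by (auto simp: lines6_def intro!: bexI[of _ i])

definition disjoint_edges :: "nat \<times> nat \<Rightarrow> nat \<times> nat \<Rightarrow> bool" where
  "disjoint_edges = (\<lambda>(i, j) (k, l). i \<noteq> k \<and> i \<noteq> l \<and> j \<noteq> k \<and> j \<noteq> l)"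

text \<open>Edges are stored with the smaller endpoint in front, and disjoint edges have different
  smaller endpoints. Comparing first components therefore lists each unordered pair exactly once;
  \<open>matchings6\<close> uses the same device.\<close>

definition pairings6 :: "((nat \<times> nat) \<times> nat \<times> nat) list" where
  "pairings6 = [(e, e'). e \<leftarrow> lines6, e' \<leftarrow> lines6, fst e < fst e' \<and> disjoint_edges e e']"

definition matchings6 :: "((nat \<times> nat) \<times> (nat \<times> nat) \<times> nat \<times> nat) list" where
  "matchings6 = [(e, e', e''). (e, e') \<leftarrow> pairings6, e'' \<leftarrow> lines6,
     fst e' < fst e'' \<and> disjoint_edges e e'' \<and> disjoint_edges e' e'']"

lemma length_lists6: "length lines6 = 15" "length pairings6 = 45" "length matchings6 = 15"
  by code_simp+

text \<open>
  The set of lines through a point off a six-arc is one of the 76 matchings of \<open>K\<^sub>6\<close>, so that the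
  inclusion-exclusion identity can be checked by evaluation.
\<close>

fun matchings_in :: "(nat \<times> nat) list \<Rightarrow> (nat \<times> nat) list list" where
  "matchings_in [] = [[]]"
| "matchings_in (e # es) = concat (map (\<lambda>m. if list_all (disjoint_edges e) m then [m, e # m] else [m]) (matchings_in es))"

text \<open>A predicate on edges matters only through the sublist that it selects. Disjointness
  places this sublist in a computable list of candidates, so a claim about all such predicates
  becomes a closed statement.\<close>

lemma filter_in_matchings_in:
  assumes "distinct xs"
    and "\<And>e e'. \<lbrakk>e \<in> set xs; e' \<in> set xs; B e; B e'; e \<noteq> e'\<rbrakk> \<Longrightarrow> disjoint_edges e e'"
  shows "filter B xs \<in> set (matchings_in xs)"
  using assms
proof (induction xs)
  case (Cons e xs)
  have "filter B xs \<in> set (matchings_in xs)"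
    using Cons.prems by (intro Cons.IH) auto
  moreover have "list_all (disjoint_edges e) (filter B xs)" if "B e"
    unfolding list_all_iff
  proof
    fix e' assume e': "e' \<in> set (filter B xs)"
    then have "e \<noteq> e'" using Cons.prems(1) by auto
    with e' that show "disjoint_edges e e'" by (intro Cons.prems(2)) auto
  qed
  ultimately show ?case by (auto intro!: bexI[of _ "filter B xs"])
qed simp

text \<open>If m edges satisfy \<open>B\<close>, then m \<le> 3 by disjointness, and the right-hand
  side is 1 - m + (m choose 2) - (m choose 3). This is 1 for m = 0 and 0 for m = 1, 2, 3, so no
  terms of higher order are needed.\<close>

lemma matching_inclusion_exclusion:
  assumes disj: "\<And>e e'. \<lbrakk>e \<in> set lines6; e' \<in> set lines6; B e; B e'; e \<noteq> e'\<rbrakk> \<Longrightarrow> disjoint_edges e e'"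
  shows "of_bool (\<forall>e\<in>set lines6. \<not> B e) = 1
    - (\<Sum>e\<leftarrow>lines6. of_bool (B e))
    + (\<Sum>(e, e')\<leftarrow>pairings6. of_bool (B e \<and> B e'))
    - (\<Sum>(e, e', e'')\<leftarrow>matchings6. of_bool (B e \<and> B e' \<and> B e'') :: int)"
proof -
  let ?S = "filter B lines6"
  \<comment> \<open>With \<open>B\<close> replaced by membership in an explicit list, the identity
    has no free variables and can be evaluated for every matching.\<close>
  have "\<forall>S\<in>set (matchings_in lines6). (if S = [] then 1 else 0) = 1
    - (\<Sum>e\<leftarrow>lines6. of_bool (e \<in> set S))
    + (\<Sum>(e, e')\<leftarrow>pairings6. of_bool (e \<in> set S \<and> e' \<in> set S))
    - (\<Sum>(e, e', e'')\<leftarrow>matchings6. of_bool (e \<in> set S \<and> e' \<in> set S \<and> e'' \<in> set S) :: int)"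
    by code_simp
  moreover have "?S \<in> set (matchings_in lines6)"
  proof (rule filter_in_matchings_in)
    show "distinct lines6" by code_simp
  qed (use disj in auto)
  ultimately have "(if ?S = [] then 1 else 0) = 1
    - (\<Sum>e\<leftarrow>lines6. of_bool (e \<in> set ?S))
    + (\<Sum>(e, e')\<leftarrow>pairings6. of_bool (e \<in> set ?S \<and> e' \<in> set ?S))
    - (\<Sum>(e, e', e'')\<leftarrow>matchings6. of_bool (e \<in> set ?S \<and> e' \<in> set ?S \<and> e'' \<in> set ?S) :: int)"
    by (rule bspec)
  moreover have "(\<Sum>e\<leftarrow>lines6. of_bool (e \<in> set ?S)) = (\<Sum>e\<leftarrow>lines6. of_bool (B e) :: int)"
    by (intro arg_cong[where f = sum_list] map_cong) auto
  moreover have "(\<Sum>(e, e')\<leftarrow>pairings6. of_bool (e \<in> set ?S \<and> e' \<in> set ?S)) =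
      (\<Sum>(e, e')\<leftarrow>pairings6. of_bool (B e \<and> B e') :: int)"
    by (intro arg_cong[where f = sum_list] map_cong) (auto simp: pairings6_def)
  moreover have "(\<Sum>(e, e', e'')\<leftarrow>matchings6. of_bool (e \<in> set ?S \<and> e' \<in> set ?S \<and> e'' \<in> set ?S)) =
      (\<Sum>(e, e', e'')\<leftarrow>matchings6. of_bool (B e \<and> B e' \<and> B e'') :: int)"
    by (intro arg_cong[where f = sum_list] map_cong) (auto simp: pairings6_def matchings6_def)
  moreover have "(if ?S = [] then 1 else 0) = (of_bool (\<forall>e\<in>set lines6. \<not> B e) :: int)"
    by (simp add: filter_empty_conv)
  ultimately show ?thesis by simp
qed

lemma matchings6D:
  assumes "((i, j), (k, l), (m, n)) \<in> set matchings6"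
  shows "distinct [i, j, k, l, m, n]" "set [i, j, k, l, m, n] = {..<6}"
proof -
  have "\<forall>((i, j), (k, l), (m, n))\<in>set matchings6. distinct [i, j, k, l, m, n] \<and> set [i, j, k, l, m, n] = set [0..<6]"
    by code_simp
  from bspec[OF this assms] have "distinct [i, j, k, l, m, n] \<and> set [i, j, k, l, m, n] = set [0..<6]"
    by (simp only: prod.case)
  then show "distinct [i, j, k, l, m, n]" "set [i, j, k, l, m, n] = {..<6}" by (auto simp: atLeast0LessThan)
qed

section \<open>Symmetry under rearrangement\<close>

lemma generic_rearrange:
  assumes "generic vs" "distinct js" "set js \<subseteq> {..<length vs}"
  shows "generic (map ((!) vs) js)"
  unfolding generic_def
proof (intro allI impI)
  fix f :: "'b \<Rightarrow> nat" assume f: "inj f" "range f \<subseteq> {..<length (map ((!) vs) js)}"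
  then have l: "f i < length js" for i by auto
  have "inj (\<lambda>i. js ! f i)"
    using f(1) l assms(2) by (auto simp: inj_def nth_eq_iff_index_eq)
  moreover have "range (\<lambda>i. js ! f i) \<subseteq> {..<length vs}" using l assms(3) nth_mem by blast
  ultimately have "det (\<chi> i. vs ! (js ! f i)) \<noteq> 0" using assms(1) unfolding generic_def by blast
  then show "det (\<chi> i. map ((!) vs) js ! f i) \<noteq> 0" using l by simp
qed

text \<open>Reindexing by a permutation is an injective map of the finite set of generic lists into
  itself, hence a bijection. This is the symmetry that makes all perfect matchings contribute
  equally.\<close>

lemma card_generic_rearrange:
  assumes js: "distinct js" "set js = {..<n}"
  shows "card {vs :: ('a::{field,finite} ^ 'n) list. length vs = n \<and> generic vs \<and> P (map ((!) vs) js)} =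
    card {vs :: ('a ^ 'n) list. length vs = n \<and> generic vs \<and> P vs}"
proof -
  let ?G = "{vs :: ('a ^ 'n) list. length vs = n \<and> generic vs}"
  let ?T = "\<lambda>vs :: ('a ^ 'n) list. map ((!) vs) js"
  have len: "length js = n" using js distinct_card[of js] by simp
  have fin: "finite ?G" by (rule finite_subset[OF _ finite_lists_length_eq[of UNIV n]]) auto
  have inj: "inj_on ?T ?G"
  proof (rule inj_onI)
    fix vs ws assume *: "vs \<in> ?G" "ws \<in> ?G" "?T vs = ?T ws"
    then have "\<forall>j\<in>set js. vs ! j = ws ! j" by simp
    with * js(2) show "vs = ws" by (intro nth_equalityI) auto
  qed
  have "?T ` ?G \<subseteq> ?G"
  proof (rule image_subsetI)
    fix vs assume "vs \<in> ?G"
    then have "generic (?T vs)" by (intro generic_rearrange) (use js in auto)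
    then show "?T vs \<in> ?G" using len by simp
  qed
  then have surj: "?T ` ?G = ?G" using endo_inj_surj[OF fin _ inj] by blast
  let ?A = "{vs \<in> ?G. P (?T vs)}"
  have "?T ` ?A = {vs \<in> ?G. P vs}"
  proof (intro equalityI subsetI)
    fix vs assume "vs \<in> ?T ` ?A"
    then show "vs \<in> {vs \<in> ?G. P vs}" using surj by blast
  next
    fix vs assume vs: "vs \<in> {vs \<in> ?G. P vs}"
    then obtain ws where "ws \<in> ?G" "vs = ?T ws" using surj by blast
    with vs show "vs \<in> ?T ` ?A" by blast
  qed
  moreover have "inj_on ?T ?A" using inj by (rule inj_on_subset) auto
  from card_image[OF this] have "card (?T ` ?A) = card ?A" .
  ultimately have "card ?A = card {vs \<in> ?G. P vs}" by (simp only:)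
  then show ?thesis by (simp add: conj_assoc)
qed

section \<open>The number of extensions of a six-arc\<close>

lemma sum_sum_list_swap:
  fixes f :: "'b \<Rightarrow> 'c \<Rightarrow> 'd::comm_monoid_add"
  shows "(\<Sum>v\<in>A. \<Sum>e\<leftarrow>xs. f e v) = (\<Sum>e\<leftarrow>xs. \<Sum>v\<in>A. f e v)"
  by (induction xs) (simp_all add: sum.distrib)

lemma sum_of_bool_card: "finite A \<Longrightarrow> (\<Sum>v\<in>A. of_bool (P v) :: int) = int (card {v \<in> A. P v})"
  by (simp add: Collect_conj_eq Int_commute)

context six_arc begin

text \<open>After division by q - 1, the vectors off the arc contribute q^2 + q - 5, the 15 lines
  -15 (q - 1), and the 45 disjoint pairs 45; together this is q^2 - 14 q + 55. Each concurrent
  triple then subtracts 1.\<close>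

lemma card_extensions:
  "int (card {v. \<forall>i<6. \<forall>j<6. i \<noteq> j \<longrightarrow> det3 (p i) (p j) v \<noteq> 0}) =
    (int CARD('a) - 1) * (int CARD('a) ^ 2 - 14 * int CARD('a) + 55
      - (\<Sum>((i, j), (k, l), (m, n))\<leftarrow>matchings6. of_bool (concurrent ((!) (map p [i, j, k, l, m, n])))))"
proof -
  let ?q = "int CARD('a)"
  have q: "int (CARD('a) - 1) = ?q - 1" by (simp add: of_nat_diff Suc_leI)
  let ?B = "\<lambda>v e. on (fst e) (snd e) v"
  have lines: "i < 6 \<and> j < 6 \<and> i < j" if "(i, j) \<in> set lines6" for i j
    using that by (simp add: lines6_iff)
  have sym: "on i j v \<longleftrightarrow> on j i v" for i j v using det3_swap[of "p i" "p j" v] by simp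
  have set_eq: "{v. \<forall>i<6. \<forall>j<6. i \<noteq> j \<longrightarrow> det3 (p i) (p j) v \<noteq> 0} = {v \<in> off. \<forall>e\<in>set lines6. \<not> ?B v e}"
  proof (intro equalityI subsetI)
    fix v assume v: "v \<in> {v. \<forall>i<6. \<forall>j<6. i \<noteq> j \<longrightarrow> det3 (p i) (p j) v \<noteq> 0}"
    have "v \<in> off" unfolding off_def
    proof (intro CollectI allI impI notI)
      fix i c assume i: "i < 6" and eq: "v = c *s p i"
      obtain j where "j < 6" "j \<noteq> i" using exists_other_index by blast
      with v i have "det3 (p i) (p j) v \<noteq> 0" by auto
      then show False unfolding eq by (simp add: det3_scale)
    qed
    moreover have "\<forall>e\<in>set lines6. \<not> ?B v e"
    proof
      fix e assume "e \<in> set lines6"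
      then show "\<not> ?B v e" using v lines[of "fst e" "snd e"] by simp
    qed
    ultimately show "v \<in> {v \<in> off. \<forall>e\<in>set lines6. \<not> ?B v e}" by blast
  next
    fix v assume v: "v \<in> {v \<in> off. \<forall>e\<in>set lines6. \<not> ?B v e}"
    have "\<not> on i j v" if "i < 6" "j < 6" "i < j" for i j
    proof -
      have "(i, j) \<in> set lines6" using that by (simp add: lines6_iff)
      then have "\<not> ?B v (i, j)" using v by blast
      then show ?thesis by simp
    qed
    then have "\<not> on i j v" if "i < 6" "j < 6" "i \<noteq> j" for i j
      using that sym[of i j v] by (metis linorder_neqE_nat)
    then show "v \<in> {v. \<forall>i<6. \<forall>j<6. i \<noteq> j \<longrightarrow> det3 (p i) (p j) v \<noteq> 0}" by simp
  qed
  have fin: "finite off" by simp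
  \<comment> \<open>Two edges can share an endpoint in four ways, and each is excluded by
    \<open>on_disjoint\<close>; this supplies the matching hypothesis of the inclusion-exclusion
    identity.\<close>
  have disj: "disjoint_edges e e'"
    if "v \<in> off" "e \<in> set lines6" "e' \<in> set lines6" "?B v e" "?B v e'" "e \<noteq> e'" for v e e'
  proof -
    obtain i j k l where e: "e = (i, j)" "e' = (k, l)" by (meson surj_pair)
    have ij: "i < 6" "j < 6" "i < j" and kl: "k < 6" "l < 6" "k < l" using lines that(2,3) e by auto
    have on: "on i j v" "on j i v" "on k l v" "on l k v" using that(4,5) sym[of i j v] sym[of k l v] by (auto simp: e)
    have "i \<noteq> k" using on_disjoint[of i j l v] on ij kl that(1,6) e by auto
    moreover have "i \<noteq> l" using on_disjoint[of i j k v] on ij kl that(1,6) e by auto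
    moreover have "j \<noteq> k" using on_disjoint[of j i l v] on ij kl that(1,6) e by auto
    moreover have "j \<noteq> l" using on_disjoint[of j i k v] on ij kl that(1,6) e by auto
    ultimately show ?thesis by (simp add: disjoint_edges_def e)
  qed
  have "int (card {v \<in> off. \<forall>e\<in>set lines6. \<not> ?B v e}) = (\<Sum>v\<in>off. of_bool (\<forall>e\<in>set lines6. \<not> ?B v e))"
    by (rule sum_of_bool_card[OF fin, symmetric])
  also have "\<dots> = (\<Sum>v\<in>off. 1
    - (\<Sum>e\<leftarrow>lines6. of_bool (?B v e))
    + (\<Sum>x\<leftarrow>pairings6. case x of (e, e') \<Rightarrow> of_bool (?B v e \<and> ?B v e'))
    - (\<Sum>x\<leftarrow>matchings6. case x of (e, e', e'') \<Rightarrow> of_bool (?B v e \<and> ?B v e' \<and> ?B v e'')))"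
    by (rule sum.cong[OF refl], rule matching_inclusion_exclusion) (rule disj)
  also have "\<dots> = int (card off)
    - (\<Sum>e\<leftarrow>lines6. \<Sum>v\<in>off. of_bool (?B v e))
    + (\<Sum>x\<leftarrow>pairings6. \<Sum>v\<in>off. case x of (e, e') \<Rightarrow> of_bool (?B v e \<and> ?B v e'))
    - (\<Sum>x\<leftarrow>matchings6. \<Sum>v\<in>off. case x of (e, e', e'') \<Rightarrow> of_bool (?B v e \<and> ?B v e' \<and> ?B v e''))"
    by (simp only: sum.distrib sum_subtractf sum_sum_list_swap) simp
  also have "(\<Sum>e\<leftarrow>lines6. \<Sum>v\<in>off. of_bool (?B v e)) = (\<Sum>e\<leftarrow>lines6. (?q - 1) ^ 2)"
  proof (intro arg_cong[where f = sum_list] map_cong refl)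
    fix e assume e: "e \<in> set lines6"
    obtain i j where ij: "e = (i, j)" by (meson surj_pair)
    have c: "card {v \<in> off. on i j v} = (CARD('a) - 1) ^ 2"
      using lines[of i j] e ij by (intro card_on_one) auto
    show "(\<Sum>v\<in>off. of_bool (?B v e)) = (?q - 1) ^ 2"
      unfolding sum_of_bool_card[OF fin] ij fst_conv snd_conv c of_nat_power q ..
  qed
  also have "(\<Sum>x\<leftarrow>pairings6. \<Sum>v\<in>off. case x of (e, e') \<Rightarrow> of_bool (?B v e \<and> ?B v e')) = (\<Sum>x\<leftarrow>pairings6. ?q - 1)"
  proof (intro arg_cong[where f = sum_list] map_cong refl)
    fix x assume x: "x \<in> set pairings6"
    obtain e e' where "x = (e, e')" by (rule prod.exhaust)
    moreover obtain i j k l where "e = (i, j)" "e' = (k, l)" by (meson surj_pair)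
    ultimately have ij: "x = ((i, j), (k, l))" by simp
    have "(i, j) \<in> set lines6" "(k, l) \<in> set lines6" "disjoint_edges (i, j) (k, l)"
      using x by (auto simp: pairings6_def ij)
    then have "card {v \<in> off. on i j v \<and> on k l v} = CARD('a) - 1"
      using lines[of i j] lines[of k l] by (intro card_on_two) (auto simp: disjoint_edges_def)
    then show "(\<Sum>v\<in>off. case x of (e, e') \<Rightarrow> of_bool (?B v e \<and> ?B v e')) = ?q - 1"
      unfolding ij prod.case fst_conv snd_conv sum_of_bool_card[OF fin] using q by simp
  qed
  also have "(\<Sum>x\<leftarrow>matchings6. \<Sum>v\<in>off. case x of (e, e', e'') \<Rightarrow> of_bool (?B v e \<and> ?B v e' \<and> ?B v e'')) =
    (\<Sum>x\<leftarrow>matchings6. (?q - 1) * (\<lambda>((i, j), (k, l), (m, n)). of_bool (concurrent ((!) (map p [i, j, k, l, m, n])))) x)"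
  proof (intro arg_cong[where f = sum_list] map_cong refl)
    fix x assume x: "x \<in> set matchings6"
    obtain e e' e'' where "x = (e, e', e'')" by (rule prod_cases3)
    moreover obtain i j k l m n where "e = (i, j)" "e' = (k, l)" "e'' = (m, n)" by (meson surj_pair)
    ultimately have ij: "x = ((i, j), (k, l), (m, n))" by simp
    have "card {v \<in> off. on i j v \<and> on k l v \<and> on m n v} =
        (if concurrent ((!) (map p [i, j, k, l, m, n])) then CARD('a) - 1 else 0)"
      using matchings6D[OF x[unfolded ij]] by (intro card_on_three) auto
    then show "(\<Sum>v\<in>off. case x of (e, e', e'') \<Rightarrow> of_bool (?B v e \<and> ?B v e' \<and> ?B v e'')) =
      (?q - 1) * (\<lambda>((i, j), (k, l), (m, n)). of_bool (concurrent ((!) (map p [i, j, k, l, m, n])))) x"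
      unfolding ij prod.case fst_conv snd_conv sum_of_bool_card[OF fin] using q by simp
  qed
  also have "\<dots> = (?q - 1) * (\<Sum>((i, j), (k, l), (m, n))\<leftarrow>matchings6. of_bool (concurrent ((!) (map p [i, j, k, l, m, n]))))"
    by (rule sum_list_const_mult)
  finally show ?thesis
    unfolding set_eq card_off by (simp add: length_lists6 sum_list_triv algebra_simps power2_eq_square power3_eq_cube)
qed

end

lemma generic_3_snoc_iff:
  fixes vs :: "('a::field ^ 3) list"
  shows "generic (vs @ [v]) \<longleftrightarrow> generic vs \<and>
    (\<forall>i<length vs. \<forall>j<length vs. i \<noteq> j \<longrightarrow> det3 (vs ! i) (vs ! j) v \<noteq> 0)"
proof -
  \<comment> \<open>The new vector may occupy any of the three arguments; moving it to the last one
    changes at most the sign.\<close>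
  have s: "det3 v u w = det3 u w v" "det3 u v w = - det3 u w v" for u w
    using det3_rotate[of v u w] det3_rotate[of u v w] det3_swap[of w u v] det3_rotate[of u w v] by simp_all
  let ?n = "length vs" and ?R = "\<forall>i<length vs. \<forall>j<length vs. i \<noteq> j \<longrightarrow> det3 (vs ! i) (vs ! j) v \<noteq> 0"
  show ?thesis
  proof
    assume g: "generic (vs @ [v])"
    have ?R
    proof (intro allI impI)
      fix i j assume "i < ?n" "j < ?n" "i \<noteq> j"
      then show "det3 (vs ! i) (vs ! j) v \<noteq> 0"
        using g[unfolded generic_3_iff, rule_format, of i j ?n] by (simp add: nth_append)
    qed
    with generic_append_left[OF g] show "generic vs \<and> ?R" ..
  next
    assume g: "generic vs \<and> ?R"
    show "generic (vs @ [v])" unfolding generic_3_iff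
    proof (intro allI impI)
      fix i j k assume l: "i < length (vs @ [v])" "j < length (vs @ [v])" "k < length (vs @ [v])"
        and d: "i \<noteq> j" "i \<noteq> k" "j \<noteq> k"
      consider "i = ?n" "j < ?n" "k < ?n" | "i < ?n" "j = ?n" "k < ?n" | "i < ?n" "j < ?n" "k = ?n"
        | "i < ?n" "j < ?n" "k < ?n" using l d by (auto simp: less_Suc_eq)
      then show "det3 ((vs @ [v]) ! i) ((vs @ [v]) ! j) ((vs @ [v]) ! k) \<noteq> 0"
      proof cases
        case 1
        then show ?thesis using g d s(1) by (simp add: nth_append)
      next
        case 2
        then show ?thesis using g d s(2) by (simp add: nth_append)
      next
        case 3
        then show ?thesis using g d by (simp add: nth_append)
      next
        case 4
        then show ?thesis using g[THEN conjunct1, unfolded generic_3_iff] d by (simp add: nth_append)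
      qed
    qed
  qed
qed

text \<open>The extension count is summed over all six-arcs and the sum over matchings is moved
  outside. For each of the 15 matchings there remains the number of arcs on which it is concurrent,
  and by rearrangement this is the number for the positions 0 1, 2 3, 4 5 tested by
  \<open>concurrent\<close>.\<close>

lemma card_generic_3_7:
  "int (card {ws :: ('a::{field,finite} ^ 3) list. length ws = 7 \<and> generic ws}) =
    (int CARD('a) - 1) * ((int CARD('a) ^ 2 - 14 * int CARD('a) + 55) *
        int (card {vs :: ('a ^ 3) list. length vs = 6 \<and> generic vs})
      - 15 * int (card {vs :: ('a ^ 3) list. length vs = 6 \<and> generic vs \<and> concurrent ((!) vs)}))"
    (is "int (card ?W) = (?q - 1) * (?c * int (card ?G) - 15 * int (card ?C))")
proof -
  let ?E = "\<lambda>vs :: ('a ^ 3) list. {v. \<forall>i<6. \<forall>j<6. i \<noteq> j \<longrightarrow> det3 (vs ! i) (vs ! j) v \<noteq> 0}"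
  let ?conc = "\<lambda>(vs :: ('a ^ 3) list) x. (\<lambda>((i, j), (k, l), (m, n)).
    (of_bool (concurrent ((!) (map ((!) vs) [i, j, k, l, m, n]))) :: int)) x"
  have fin: "finite ?G" by (rule finite_subset[OF _ finite_lists_length_eq[of UNIV 6]]) auto
  have "?W = (\<lambda>(vs, v). vs @ [v]) ` (SIGMA vs : ?G. ?E vs)"
  proof (intro equalityI subsetI)
    fix ws assume ws: "ws \<in> ?W"
    then have "ws \<noteq> []" by auto
    then obtain vs v where e: "ws = vs @ [v]" by (metis append_butlast_last_id)
    have "vs \<in> ?G" "v \<in> ?E vs" using ws generic_3_snoc_iff[of vs v] unfolding e by auto
    then show "ws \<in> (\<lambda>(vs, v). vs @ [v]) ` (SIGMA vs : ?G. ?E vs)" unfolding e by force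
  next
    fix ws assume "ws \<in> (\<lambda>(vs, v). vs @ [v]) ` (SIGMA vs : ?G. ?E vs)"
    then obtain vs v where "ws = vs @ [v]" "vs \<in> ?G" "v \<in> ?E vs" by auto
    then show "ws \<in> ?W" using generic_3_snoc_iff[of vs v] by simp
  qed
  moreover have "inj_on (\<lambda>(vs, v). vs @ [v]) (SIGMA vs : ?G. ?E vs)" by (auto simp: inj_on_def)
  ultimately have "card ?W = card (SIGMA vs : ?G. ?E vs)" by (simp add: card_image)
  also have "\<dots> = (\<Sum>vs\<in>?G. card (?E vs))" using fin by (intro card_SigmaI) auto
  finally have "int (card ?W) = (\<Sum>vs\<in>?G. int (card (?E vs)))" by simp
  also have "\<dots> = (\<Sum>vs\<in>?G. (?q - 1) * (?c - (\<Sum>x\<leftarrow>matchings6. ?conc vs x)))"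
  proof (rule sum.cong[OF refl])
    fix vs assume "vs \<in> ?G"
    then interpret six_arc "(!) vs"
      by unfold_locales (auto simp: generic_3_iff)
    show "int (card (?E vs)) = (?q - 1) * (?c - (\<Sum>x\<leftarrow>matchings6. ?conc vs x))"
      using card_extensions .
  qed
  also have "\<dots> = (?q - 1) * (?c * int (card ?G) - (\<Sum>x\<leftarrow>matchings6. \<Sum>vs\<in>?G. ?conc vs x))"
    by (simp only: sum_distrib_left[symmetric] sum_subtractf sum_sum_list_swap sum_constant mult.commute)
  also have "(\<Sum>x\<leftarrow>matchings6. \<Sum>vs\<in>?G. ?conc vs x) = (\<Sum>x\<leftarrow>matchings6. int (card ?C))"
  proof (intro arg_cong[where f = sum_list] map_cong refl)
    fix x assume x: "x \<in> set matchings6"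
    obtain e e' e'' where "x = (e, e', e'')" by (rule prod_cases3)
    moreover obtain i j k l m n where "e = (i, j)" "e' = (k, l)" "e'' = (m, n)" by (meson surj_pair)
    ultimately have ij: "x = ((i, j), (k, l), (m, n))" by simp
    show "(\<Sum>vs\<in>?G. ?conc vs x) = int (card ?C)"
      unfolding ij prod.case sum_of_bool_card[OF fin]
      using card_generic_rearrange[OF matchings6D[OF x[unfolded ij]], where P = "\<lambda>vs. concurrent ((!) vs)" and 'a = 'a and 'n = 3]
      by (simp only: mem_Collect_eq conj_assoc)
  qed
  finally show ?thesis by (simp add: sum_list_triv length_lists6)
qed

section \<open>Lists containing the standard basis\<close>

lemma det_4:
  "det (A::'a::comm_ring_1^4^4) =
     A$1$1 * (A$2$2 * (A$3$3 * A$4$4 - A$3$4 * A$4$3) - A$2$3 * (A$3$2 * A$4$4 - A$3$4 * A$4$2) + A$2$4 * (A$3$2 * A$4$3 - A$3$3 * A$4$2)) -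
     A$1$2 * (A$2$1 * (A$3$3 * A$4$4 - A$3$4 * A$4$3) - A$2$3 * (A$3$1 * A$4$4 - A$3$4 * A$4$1) + A$2$4 * (A$3$1 * A$4$3 - A$3$3 * A$4$1)) +
     A$1$3 * (A$2$1 * (A$3$2 * A$4$4 - A$3$4 * A$4$2) - A$2$2 * (A$3$1 * A$4$4 - A$3$4 * A$4$1) + A$2$4 * (A$3$1 * A$4$2 - A$3$2 * A$4$1)) -
     A$1$4 * (A$2$1 * (A$3$2 * A$4$3 - A$3$3 * A$4$2) - A$2$2 * (A$3$1 * A$4$3 - A$3$3 * A$4$1) + A$2$3 * (A$3$1 * A$4$2 - A$3$2 * A$4$1))"
proof -
  have f1: "finite {2::4, 3, 4}" "1 \<notin> {2::4, 3, 4}" by auto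
  have f2: "finite {3::4, 4}" "2 \<notin> {3::4, 4}" by auto
  have f3: "finite {4::4}" "3 \<notin> {4::4}" by auto
  show ?thesis
    unfolding det_def UNIV_4
    unfolding sum_over_permutations_insert[OF f1]
    unfolding sum_over_permutations_insert[OF f2]
    unfolding sum_over_permutations_insert[OF f3]
    unfolding permutes_sing
    by (simp add: sign_swap_id permutation_swap_id sign_compose permutation_compose sign_id swap_id_eq algebra_simps)
qed

text \<open>The two selections differ by a permutation of the rows, which changes the determinant
  only by a sign.\<close>

lemma det_rows_same_range:
  fixes f g :: "'n::finite \<Rightarrow> nat" and vs :: "('a::field ^ 'n) list"
  assumes "inj f" "inj g" "range f = range g"
  shows "det (\<chi> x. vs ! f x) = 0 \<longleftrightarrow> det (\<chi> x. vs ! g x) = 0"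
proof -
  define p where "p = (\<lambda>x. inv_into UNIV g (f x))"
  have gp: "g (p x) = f x" for x
    using assms(3) unfolding p_def by (metis f_inv_into_f rangeI)
  have "inj p" using gp assms(1) by (metis injD injI)
  then have "bij p" by (simp add: bij_def finite_UNIV_inj_surj)
  then have "p permutes UNIV" by (rule bij_imp_permutes) simp
  then have "det (\<chi> x. (\<chi> x. vs ! g x) $ p x) = of_int (sign p) * det (\<chi> x. vs ! g x)"
    by (rule det_permute_rows)
  moreover have "(of_int (sign p) :: 'a) \<noteq> 0" by (simp add: sign_def)
  ultimately show ?thesis by (simp add: gp)
qed

definition det4 :: "'a::field ^ 4 \<Rightarrow> 'a ^ 4 \<Rightarrow> 'a ^ 4 \<Rightarrow> 'a ^ 4 \<Rightarrow> 'a" where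
  "det4 t u v w = det (\<chi> i. if i = 1 then t else if i = 2 then u else if i = 3 then v else w)"

lemmas det4_eq = det4_def[unfolded det_4, simplified]

text \<open>For seven entries this leaves 35 determinants instead of 840, few enough for the
  simplifier to expand all of them.\<close>

lemma generic_4_iff_sorted:
  "generic (vs :: ('a::field ^ 4) list) \<longleftrightarrow>
    (\<forall>l<length vs. \<forall>k<l. \<forall>j<k. \<forall>i<j. det4 (vs ! i) (vs ! j) (vs ! k) (vs ! l) \<noteq> 0)" (is "_ \<longleftrightarrow> ?R")
proof -
  let ?f = "\<lambda>i j k l (x :: 4). if x = 1 then i else if x = 2 then j else if x = 3 then k else l :: nat"
  have det4: "det4 (vs ! i) (vs ! j) (vs ! k) (vs ! l) = det (\<chi> x. vs ! ?f i j k l x)" for i j k l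
    unfolding det4_def by (intro arg_cong[where f = det]) (simp add: vec_eq_iff)
  have rng: "range (?f i j k l) = {i, j, k, l}" for i j k l
    unfolding UNIV_4 by (simp add: insert_commute)
  have inj: "inj (?f i j k l)" if "i < j" "j < k" "k < l" for i j k l
  proof (rule injI)
    fix x y assume "?f i j k l x = ?f i j k l y"
    then show "x = y" using that exhaust_4[of x] exhaust_4[of y] by (auto split: if_splits)
  qed
  show ?thesis
  proof
    assume g: "generic vs"
    show ?R
    proof (intro allI impI)
      fix i j k l assume l: "l < length vs" "k < l" "j < k" "i < j"
      then have "det (\<chi> x. vs ! ?f i j k l x) \<noteq> 0"
        using g inj[of i j k l] rng[of i j k l] unfolding generic_def by auto
      then show "det4 (vs ! i) (vs ! j) (vs ! k) (vs ! l) \<noteq> 0" unfolding det4 .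
    qed
  next
    assume R: ?R
    show "generic vs" unfolding generic_def
    proof (intro allI impI)
      fix f :: "4 \<Rightarrow> nat" assume f: "inj f" "range f \<subseteq> {..<length vs}"
      define xs where "xs = sorted_list_of_set (range f)"
      have "length xs = 4" using f(1) by (simp add: xs_def card_image)
      then obtain i j k l where xs: "xs = [i, j, k, l]"
        by (auto simp: numeral_eq_Suc length_Suc_conv)
      have "sorted xs" "distinct xs" "set xs = range f" unfolding xs_def by simp_all
      then have ord: "i < j" "j < k" "k < l" and r: "range f = {i, j, k, l}" unfolding xs by auto
      have "l < length vs" using f(2) unfolding r by auto
      then have "det (\<chi> x. vs ! ?f i j k l x) \<noteq> 0" using R ord unfolding det4 by auto
      then show "det (\<chi> x. vs ! f x) \<noteq> 0"
        using det_rows_same_range[OF f(1) inj[OF ord], of vs] rng[of i j k l] r by auto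
    qed
  qed
qed

lemma generic_3_iff_sorted:
  "generic (vs :: ('a::field ^ 3) list) \<longleftrightarrow>
    (\<forall>k<length vs. \<forall>j<k. \<forall>i<j. det3 (vs ! i) (vs ! j) (vs ! k) \<noteq> 0)" (is "_ \<longleftrightarrow> ?R")
proof
  assume g: "generic vs"
  show ?R
  proof (intro allI impI)
    fix i j k assume "k < length vs" "j < k" "i < j"
    then show "det3 (vs ! i) (vs ! j) (vs ! k) \<noteq> 0"
      using g[unfolded generic_3_iff, rule_format, of i j k] by simp
  qed
next
  assume R: ?R
  have R: "det3 (vs ! i) (vs ! j) (vs ! k) \<noteq> 0" if "i < j" "j < k" "k < length vs" for i j k
    using R that by blast
  have s: "det3 u v w = - det3 v u w" "det3 u v w = - det3 u w v" for u v w :: "'a ^ 3"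
    by (simp_all add: det3_eq algebra_simps)
  show "generic vs" unfolding generic_3_iff
  proof (intro allI impI)
    fix i j k assume l: "i < length vs" "j < length vs" "k < length vs" and d: "i \<noteq> j" "i \<noteq> k" "j \<noteq> k"
    let ?u = "vs ! i" and ?v = "vs ! j" and ?w = "vs ! k"
    consider "i < j" "j < k" | "i < k" "k < j" | "j < i" "i < k" | "j < k" "k < i" | "k < i" "i < j" | "k < j" "j < i"
      using d by linarith
    then show "det3 ?u ?v ?w \<noteq> 0"
    proof cases
      case 1 then show ?thesis using R l by simp
    next
      case 2 then show ?thesis using R[of i k j] l s(2)[of ?u ?v ?w] by simp
    next
      case 3 then show ?thesis using R[of j i k] l s(1)[of ?u ?v ?w] by simp
    next
      case 4 then show ?thesis using R[of j k i] l det3_rotate[of ?v ?w ?u] by simp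
    next
      case 5 then show ?thesis using R[of k i j] l det3_rotate[of ?u ?v ?w] by simp
    next
      case 6 then show ?thesis using R[of k j i] l s(2)[of ?w ?v ?u] det3_rotate[of ?u ?v ?w] by simp
    qed
  qed
qed

section \<open>Genericity in the presence of the standard basis\<close>

lemma generic_frame_4_1:
  "generic (frame [1, 2, 3, 4] @ [y :: 'a::field ^ 4]) \<longleftrightarrow> y$1 \<noteq> 0 \<and> y$2 \<noteq> 0 \<and> y$3 \<noteq> 0 \<and> y$4 \<noteq> 0"
  unfolding generic_4_iff_sorted by (simp add: frame_def All_less_Suc det4_eq axis_def)

text \<open>Every basis vector in a determinant deletes its own column, so the conditions concern
  the minors of the 2-by-4 block with rows \<open>y\<close> and \<open>z\<close>: its eight entries
  and its six 2-by-2 minors.\<close>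

lemma generic_frame_4_2:
  "generic (frame [1, 2, 3, 4] @ [y, z :: 'a::field ^ 4]) \<longleftrightarrow>
    y$1 \<noteq> 0 \<and> y$2 \<noteq> 0 \<and> y$3 \<noteq> 0 \<and> y$4 \<noteq> 0 \<and> z$1 \<noteq> 0 \<and> z$2 \<noteq> 0 \<and> z$3 \<noteq> 0 \<and> z$4 \<noteq> 0 \<and>
    y$1 * z$2 \<noteq> y$2 * z$1 \<and> y$3 * z$1 \<noteq> y$1 * z$3 \<and> y$2 * z$3 \<noteq> y$3 * z$2 \<and>
    y$1 * z$4 \<noteq> y$4 * z$1 \<and> y$4 * z$2 \<noteq> y$2 * z$4 \<and> y$3 * z$4 \<noteq> y$4 * z$3"
  unfolding generic_4_iff_sorted by (simp add: frame_def All_less_Suc det4_eq axis_def conj_ac)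

lemma generic_frame_3_3:
  "generic (frame [1, 2, 3] @ [y, z, w :: 'a::field ^ 3]) \<longleftrightarrow>
    y$1 \<noteq> 0 \<and> y$2 \<noteq> 0 \<and> y$3 \<noteq> 0 \<and> z$1 \<noteq> 0 \<and> z$2 \<noteq> 0 \<and> z$3 \<noteq> 0 \<and> w$1 \<noteq> 0 \<and> w$2 \<noteq> 0 \<and> w$3 \<noteq> 0 \<and>
    y$1 * z$2 \<noteq> y$2 * z$1 \<and> y$3 * z$1 \<noteq> y$1 * z$3 \<and> y$2 * z$3 \<noteq> y$3 * z$2 \<and>
    y$1 * w$2 \<noteq> y$2 * w$1 \<and> y$3 * w$1 \<noteq> y$1 * w$3 \<and> y$2 * w$3 \<noteq> y$3 * w$2 \<and>
    z$1 * w$2 \<noteq> z$2 * w$1 \<and> z$3 * w$1 \<noteq> z$1 * w$3 \<and> z$2 * w$3 \<noteq> z$3 * w$2 \<and>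
    det3 y z w \<noteq> 0"
  unfolding generic_3_iff_sorted by (simp add: frame_def All_less_Suc det3_eq axis_def conj_ac)

text \<open>Both sides say that the square minors of sizes 1 to 3 of the matrix with rows
  \<open>a\<close>, \<open>b\<close>, \<open>c\<close>, \<open>d\<close> are all nonzero; on the
  left the matrix appears transposed. There are 12 + 18 + 4 of them, which together with the frame
  itself account for the 35 selections of four, or of three, out of seven.\<close>

lemma generic_frame_transpose:
  fixes a b c d :: "'a::field ^ 3"
  shows "generic (frame [1, 2, 3, 4 :: 4] @
      map (\<lambda>k. \<chi> i. (if i = 1 then a else if i = 2 then b else if i = 3 then c else d) $ k) [1, 2, 3])
    \<longleftrightarrow> generic (frame [1, 2, 3] @ [a, b, c, d])"
  unfolding generic_3_iff_sorted generic_4_iff_sorted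
  by (simp add: frame_def All_less_Suc det3_eq det4_eq axis_def) (auto simp: algebra_simps)

section \<open>Counting completions of the frame in dimension four\<close>

lemma card_Collect_vec:
  "card {v :: 'a::finite ^ 'n. \<forall>i. v $ i \<in> S} = card S ^ CARD('n)"
proof -
  have "bij_betw vec_nth {v :: 'a ^ 'n. \<forall>i. v $ i \<in> S} (PiE UNIV (\<lambda>_. S))"
    by (rule bij_betwI[where g = vec_lambda]) auto
  from bij_betw_same_card[OF this] show ?thesis by (simp add: card_PiE)
qed

text \<open>Over the integers the product has a zero factor when \<open>A\<close> has fewer than
  four elements, so small fields need not be excluded.\<close>

lemma int_card_distinct_lists_4:
  fixes A :: "'a::finite set"
  shows "int (card {xs. length xs = 4 \<and> distinct xs \<and> set xs \<subseteq> A}) =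
    int (card A) * (int (card A) - 1) * (int (card A) - 2) * (int (card A) - 3)"
proof (cases "card A \<ge> 4")
  case True
  then obtain m where m: "card A = m + 4" using le_Suc_ex by (metis add.commute)
  have "card {xs. length xs = 4 \<and> distinct xs \<and> set xs \<subseteq> A} = \<Prod>{card A - 4 + 1..card A}"
    using True by (intro card_lists_distinct_length_eq) auto
  also have "\<dots> = (m + 1) * (m + 2) * (m + 3) * (m + 4)"
    unfolding m by (simp add: numeral_eq_Suc)
  finally show ?thesis by (simp add: m algebra_simps)
next
  case False
  have "{xs. length xs = 4 \<and> distinct xs \<and> set xs \<subseteq> A} = {}"
  proof (intro equals0I)
    fix xs assume "xs \<in> {xs. length xs = 4 \<and> distinct xs \<and> set xs \<subseteq> A}"
    then have "card (set xs) = 4" "set xs \<subseteq> A" using distinct_card[of xs] by auto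
    then have "4 \<le> card A" using card_mono[of A "set xs"] by simp
    with False show False by simp
  qed
  then have "card {xs. length xs = 4 \<and> distinct xs \<and> set xs \<subseteq> A} = 0" by (simp only: card.empty)
  moreover have "card A = 0 \<or> card A = 1 \<or> card A = 2 \<or> card A = 3" using False by linarith
  ultimately show ?thesis by (elim disjE) simp_all
qed

abbreviation nonzero :: "'a::field set" where
  "nonzero \<equiv> UNIV - {0}"

lemma card_nonzero: "int (card (nonzero :: 'a::{field,finite} set)) = int CARD('a) - 1"
  by (simp add: card_Diff_subset of_nat_diff Suc_leI)

lemma card_frame_4_1:
  "card {ys :: ('a::{field,finite} ^ 4) list. length ys = 1 \<and> generic (frame [1, 2, 3, 4] @ ys)} =
    card (nonzero :: 'a set) ^ 4"
proof -
  have "bij_betw (\<lambda>y. [y]) {y :: 'a ^ 4. \<forall>i. y $ i \<in> nonzero}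
      {ys :: ('a ^ 4) list. length ys = 1 \<and> generic (frame [1, 2, 3, 4] @ ys)}"
    by (rule bij_betwI[where g = hd]) (auto simp: generic_frame_4_1 forall_4 length_Suc_conv)
  from bij_betw_same_card[OF this] show ?thesis unfolding card_Collect_vec by simp
qed

text \<open>In terms of the ratios of the coordinates of the second vector to those of the first,
  the conditions on entries say that the ratios are nonzero and the 2-by-2 minors say that they are
  pairwise distinct.\<close>

lemma card_frame_4_2:
  "card {ys :: ('a::{field,finite} ^ 4) list. length ys = 2 \<and> generic (frame [1, 2, 3, 4] @ ys)} =
    card (nonzero :: 'a set) ^ 4 * card {xs :: 'a list. length xs = 4 \<and> distinct xs \<and> set xs \<subseteq> nonzero}"
    (is "card ?Y = _ * card ?X")
proof -
  let ?N = "{y :: 'a ^ 4. \<forall>i. y $ i \<in> nonzero}"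
  let ?f = "\<lambda>(y :: 'a ^ 4, xs). [y, \<chi> i. y $ i * (if i = 1 then xs ! 0 else if i = 2 then xs ! 1 else if i = 3 then xs ! 2 else xs ! 3)]"
  let ?g = "\<lambda>ys :: ('a ^ 4) list. (ys ! 0, map (\<lambda>i. (ys ! 1) $ i / (ys ! 0) $ i) [1, 2, 3, 4])"
  have N: "y \<in> ?N \<longleftrightarrow> y$1 \<noteq> 0 \<and> y$2 \<noteq> 0 \<and> y$3 \<noteq> 0 \<and> y$4 \<noteq> 0" for y by (simp add: forall_4)
  have X: "xs \<in> ?X \<longleftrightarrow> (\<exists>a b c d. xs = [a, b, c, d] \<and> distinct [a, b, c, d] \<and> {a, b, c, d} \<subseteq> nonzero)" for xs
    by (auto simp: numeral_eq_Suc length_Suc_conv)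
  have Y: "ys \<in> ?Y \<longleftrightarrow> (\<exists>y z. ys = [y, z] \<and> generic (frame [1, 2, 3, 4] @ [y, z]))" for ys
    by (auto simp: numeral_2_eq_2 length_Suc_conv)
  have "bij_betw ?f (?N \<times> ?X) ?Y"
  proof (rule bij_betwI[where g = ?g])
    show "?f \<in> ?N \<times> ?X \<rightarrow> ?Y"
    proof
      fix p assume "p \<in> ?N \<times> ?X"
      then obtain y xs where p: "p = (y, xs)" "y \<in> ?N" "xs \<in> ?X" by (cases p) simp
      then obtain a b c d where x: "xs = [a, b, c, d]" "distinct [a, b, c, d]" "{a, b, c, d} \<subseteq> nonzero"
        unfolding X by blast
      have "generic (frame [1, 2, 3, 4] @ ?f p)"
        using p(2) x(2,3) unfolding N p(1) x(1) prod.case generic_frame_4_2 by auto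
      then show "?f p \<in> ?Y" by (simp add: p)
    qed
    show "?g \<in> ?Y \<rightarrow> ?N \<times> ?X"
    proof
      fix ys assume "ys \<in> ?Y"
      then obtain y z where ys: "ys = [y, z]" "generic (frame [1, 2, 3, 4] @ [y, z])" unfolding Y by blast
      show "?g ys \<in> ?N \<times> ?X"
        using ys(2) unfolding ys(1) generic_frame_4_2 by (auto simp: forall_4 frac_eq_eq mult.commute)
    qed
    fix p assume "p \<in> ?N \<times> ?X"
    then obtain y xs where p: "p = (y, xs)" "y \<in> ?N" "xs \<in> ?X" by (cases p) simp
    then obtain a b c d where "xs = [a, b, c, d]" unfolding X by blast
    with p show "?g (?f p) = p" by (simp add: forall_4)
  next
    fix ys assume "ys \<in> ?Y"
    then obtain y z where ys: "ys = [y, z]" "generic (frame [1, 2, 3, 4] @ [y, z])" unfolding Y by blast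
    then show "?f (?g ys) = ys" by (simp add: generic_frame_4_2 vec_eq_iff forall_4)
  qed
  from bij_betw_same_card[OF this] show ?thesis unfolding card_cartesian_product card_Collect_vec by simp
qed

text \<open>The three vectors in dimension four are the columns of the matrix whose rows are the
  four vectors in dimension three.\<close>

lemma card_frame_4_3:
  "card {ys :: ('a::{field,finite} ^ 4) list. length ys = 3 \<and> generic (frame [1, 2, 3, 4] @ ys)} =
    card {xs :: ('a ^ 3) list. length xs = 4 \<and> generic (frame [1, 2, 3] @ xs)}"
    (is "card ?Y = card ?X")
proof -
  let ?f = "\<lambda>xs :: ('a ^ 3) list. map (\<lambda>k. \<chi> i :: 4. (if i = 1 then xs ! 0 else if i = 2 then xs ! 1 else if i = 3 then xs ! 2 else xs ! 3) $ k) [1, 2, 3]"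
  let ?g = "\<lambda>ys :: ('a ^ 4) list. map (\<lambda>i. \<chi> k :: 3. (if k = 1 then ys ! 0 else if k = 2 then ys ! 1 else ys ! 2) $ i) [1, 2, 3, 4]"
  have f: "generic (frame [1, 2, 3, 4] @ ?f [a, b, c, d]) \<longleftrightarrow> generic (frame [1, 2, 3] @ [a, b, c, d])" for a b c d
  proof -
    have "?f [a, b, c, d] = map (\<lambda>k. \<chi> i. (if i = 1 then a else if i = 2 then b else if i = 3 then c else d) $ k) [1, 2, 3]"
      by (simp add: vec_eq_iff)
    then show ?thesis using generic_frame_transpose[of a b c d] by (simp only:)
  qed
  have fg: "?f (?g [x, y, z]) = [x, y, z]" for x y z by (simp add: vec_eq_iff forall_4)
  have gf: "?g (?f [a, b, c, d]) = [a, b, c, d]" for a b c d by (simp add: vec_eq_iff forall_3)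
  have X: "xs \<in> ?X \<longleftrightarrow> (\<exists>a b c d. xs = [a, b, c, d] \<and> generic (frame [1, 2, 3] @ [a, b, c, d]))" for xs
    by (auto simp: numeral_eq_Suc length_Suc_conv)
  have Y: "ys \<in> ?Y \<longleftrightarrow> (\<exists>x y z. ys = [x, y, z] \<and> generic (frame [1, 2, 3, 4] @ [x, y, z]))" for ys
    by (auto simp: numeral_3_eq_3 length_Suc_conv)
  have "bij_betw ?f ?X ?Y"
  proof (rule bij_betwI[where g = ?g])
    show "?f \<in> ?X \<rightarrow> ?Y"
    proof
      fix xs assume "xs \<in> ?X"
      then obtain a b c d where xs: "xs = [a, b, c, d]" "generic (frame [1, 2, 3] @ [a, b, c, d])" unfolding X by blast
      have "generic (frame [1, 2, 3, 4] @ ?f xs)" using xs(2) f[of a b c d] unfolding xs(1) by (simp only:)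
      then show "?f xs \<in> ?Y" by simp
    qed
    show "?g \<in> ?Y \<rightarrow> ?X"
    proof
      fix ys assume "ys \<in> ?Y"
      then obtain x y z where ys: "ys = [x, y, z]" "generic (frame [1, 2, 3, 4] @ [x, y, z])" unfolding Y by blast
      obtain a b c d where g: "?g ys = [a, b, c, d]" by simp
      have "?f [a, b, c, d] = [x, y, z]" unfolding g[symmetric] unfolding ys(1) by (rule fg)
      then have "generic (frame [1, 2, 3] @ ?g ys)" using ys(2) f[of a b c d] unfolding g by simp
      then show "?g ys \<in> ?X" by simp
    qed
    show "?g (?f xs) = xs" if "xs \<in> ?X" for xs using that unfolding X by (elim exE conjE) (simp only: gf)
    show "?f (?g ys) = ys" if "ys \<in> ?Y" for ys using that unfolding Y by (elim exE conjE) (simp only: fg)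
  qed
  from bij_betw_same_card[OF this] show ?thesis by simp
qed

section \<open>Characteristic two and the parity of the field size\<close>

text \<open>The characteristic is a prime dividing the prime power \<open>CARD('a)\<close>, hence it
  is the base of that power.\<close>

lemma even_card_field_iff:
  assumes "primepow (int CARD('a::{field,finite}))"
  shows "even CARD('a) \<longleftrightarrow> (2 :: 'a) = 0"
proof -
  obtain p k where p: "prime (p :: int)" "k > 0" "int CARD('a) = p ^ k"
    using assms by (auto simp: primepow_def)
  have two: "(2 :: 'a) = 0 \<longleftrightarrow> CHAR('a) dvd 2"
    using of_nat_eq_0_iff_char_dvd[of 2, where 'a = 'a] by simp
  have "prime CHAR('a)" by (rule prime_CHAR_semidom) (simp add: finite_imp_CHAR_pos)
  then have pc: "prime (int CHAR('a))" by simp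
  have eq_2: "CHAR('a) dvd 2 \<longleftrightarrow> CHAR('a) = 2" "2 dvd CHAR('a) \<longleftrightarrow> CHAR('a) = 2"
    using primes_dvd_imp_eq[OF \<open>prime CHAR('a)\<close> two_is_prime_nat]
      primes_dvd_imp_eq[OF two_is_prime_nat \<open>prime CHAR('a)\<close>] by auto
  have "int CHAR('a) dvd int CARD('a)" using CHAR_dvd_CARD[where 'a = 'a] by simp
  then have "int CHAR('a) dvd p" unfolding p(3) by (rule prime_dvd_power[OF pc])
  then have c: "int CHAR('a) = p" by (rule primes_dvd_imp_eq[OF pc p(1)])
  have "even (int CARD('a)) \<longleftrightarrow> even (int CHAR('a))" unfolding p(3) c using p(2) by simp
  then show ?thesis using two eq_2 by simp
qed

text \<open>
  The quadruples for which \<open>(1, 0, 0)\<close>, \<open>(0, 1, 0)\<close>, \<open>(0, 0, 1)\<close>, \<open>(1, 1, 1)\<close>, \<open>(x, y, 1)\<close>, \<open>(s, t, 1)\<close> form a six-arc.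
\<close>

definition normal_six :: "('a::field \<times> 'a \<times> 'a \<times> 'a) set" where
  "normal_six = {(x, y, s, t). x \<noteq> 0 \<and> x \<noteq> 1 \<and> y \<noteq> 0 \<and> y \<noteq> 1 \<and> y \<noteq> x \<and> s \<noteq> 0 \<and> s \<noteq> 1 \<and> s \<noteq> x \<and>
     t \<noteq> 0 \<and> t \<noteq> 1 \<and> t \<noteq> y \<and> t \<noteq> s \<and> x * t \<noteq> y * s \<and> (x - 1) * (t - 1) \<noteq> (y - 1) * (s - 1)}"

section \<open>Counting six-arcs of the plane in normal form\<close>

lemma card_Compl_add:
  fixes A :: "'a::finite set"
  shows "card (- A) + card A = CARD('a)"
  using card_Un_disjoint[of "- A" A] by (simp add: Compl_partition2)

lemma int_card_Compl_set:
  "distinct xs \<Longrightarrow> int (card (- set (xs :: 'a::finite list))) = int CARD('a) - int (length xs)"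
  using card_Compl_add[of "set xs"] by (simp add: distinct_card)

lemma int_card_Sigma:
  fixes A :: "'a::finite set" and B :: "'a \<Rightarrow> 'b::finite set"
  shows "int (card (Sigma A B)) = (\<Sum>x\<in>A. int (card (B x)))"
  by (simp add: card_SigmaI)

text \<open>For fixed \<open>s\<close>, the last point must avoid six values of \<open>t\<close>: 0,
  1, \<open>y\<close>, \<open>s\<close>, and the values \<open>u\<close> and \<open>v\<close> at
  which it lies on the line from (x, y) through the origin or through (1, 1). The only possible
  coincidences are \<open>s = y\<close>, \<open>u = 1\<close> and \<open>v = 0\<close>, and each
  gives back one value.\<close>

lemma card_normal_six_fibre:
  fixes x y s :: "'a::{field,finite}"
  assumes x: "x \<noteq> 0" "x \<noteq> 1" and y: "y \<noteq> 0" "y \<noteq> 1" "y \<noteq> x" and s: "s \<noteq> 0" "s \<noteq> 1" "s \<noteq> x"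
  shows "int (card {t. (x, y, s, t) \<in> normal_six}) =
    int CARD('a) - 6 + of_bool (s = y) + of_bool (s = x / y) + of_bool (s = (y - x) / (y - 1))"
proof -
  define u where "u = y * s / x"
  define w where "w = (y - 1) * (s - 1) / (x - 1)"
  define v where "v = 1 + w"
  have xu: "x * u = y * s" using x by (simp add: u_def)
  have xw: "(x - 1) * w = (y - 1) * (s - 1)" using x by (simp add: w_def)
  have u: "x * t = y * s \<longleftrightarrow> t = u" for t using x by (simp flip: xu)
  have v: "(x - 1) * (t - 1) = (y - 1) * (s - 1) \<longleftrightarrow> t = v" for t
  proof -
    have "(x - 1) * (t - 1) = (y - 1) * (s - 1) \<longleftrightarrow> t - 1 = w"
      using x by (simp flip: xw)
    then show ?thesis by (simp add: v_def diff_eq_eq add.commute)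
  qed
  have eq: "{t. (x, y, s, t) \<in> normal_six} = - {0, 1, y, s, u, v}"
    unfolding normal_six_def using x y s by (simp add: u v set_eq_iff)
  have ne: "y \<noteq> u" "s \<noteq> u" "0 \<noteq> u"
    using x y s u[of y] u[of s] u[of 0] by (simp_all add: mult.commute[of x])
  have ne': "y \<noteq> v" "s \<noteq> v" "1 \<noteq> v"
    using x y s v[of y] v[of s] v[of 1] by (simp_all add: mult.commute[of "x - 1"])
  have uv: "u \<noteq> v"
  proof
    assume "u = v"
    then have e: "(x - 1) * (u - 1) = (y - 1) * (s - 1)" using v by simp
    \<comment> \<open>Eliminating \<open>u\<close> between the equations of the two lines through
      (x, y): they have a second common point only if \<open>x = y\<close>.\<close>
    have "(x - y) * (s - x) = x * ((x - 1) * (u - 1) - (y - 1) * (s - 1)) - (x - 1) * (x * u - y * s)"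
      by (simp add: algebra_simps)
    also have "\<dots> = 0" by (simp add: e xu)
    finally show False using y s by simp
  qed
  have u1: "1 = u \<longleftrightarrow> s = x / y" 
  proof -
    have "1 = u \<longleftrightarrow> x = y * s" using u[of 1] by simp
    also have "\<dots> \<longleftrightarrow> s = x / y" using y by (auto simp: eq_divide_eq mult.commute[of y])
    finally show ?thesis .
  qed
  have v0: "0 = v \<longleftrightarrow> s = (y - x) / (y - 1)"
  proof -
    have "0 = v \<longleftrightarrow> (x - 1) * (0 - 1) = (y - 1) * (s - 1)" using v[of 0] by simp
    also have "\<dots> \<longleftrightarrow> s * (y - 1) = y - x" by (auto simp: algebra_simps)
    finally show ?thesis using y by (simp add: eq_divide_eq)
  qed
  have "card {0, 1, y, s, u, v} + of_bool (s = y) + of_bool (1 = u) + of_bool (0 = v) = 6"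
    using ne ne' uv x(1) y(1,2) s(1,2) by (simp add: card_insert_if eq_commute[of y s])
  moreover have "card (- {0, 1, y, s, u, v}) + card {0, 1, y, s, u, v} = CARD('a)"
    by (rule card_Compl_add)
  ultimately have "card (- {0, 1, y, s, u, v}) + 6 = CARD('a) + of_bool (s = y) + of_bool (1 = u) + of_bool (0 = v)"
    by linarith
  then have "int (card (- {0, 1, y, s, u, v}) + 6) = int (CARD('a) + of_bool (s = y) + of_bool (1 = u) + of_bool (0 = v))"
    by (simp only:)
  then show ?thesis unfolding eq u1 v0 by simp
qed

text \<open>For given \<open>x\<close> and \<open>y\<close>, each of the three exceptional values of
  \<open>s\<close> lies in the admissible range, so each contributes 1 whether or not they coincide.
  The sum over \<open>s\<close> is (q - 3) (q - 6) + 3 = q^2 - 9 q + 21.\<close>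

lemma card_normal_six:
  "int (card (normal_six :: ('a::{field,finite} \<times> 'a \<times> 'a \<times> 'a) set)) =
    (int CARD('a) - 2) * (int CARD('a) - 3) * (int CARD('a) ^ 2 - 9 * int CARD('a) + 21)"
proof -
  let ?q = "int CARD('a)"
  let ?A = "- {0, 1} :: 'a set" and ?B = "\<lambda>x. - {0, 1, x} :: 'a set"
  have A: "int (card ?A) = ?q - 2" using int_card_Compl_set[of "[0, 1 :: 'a]"] by simp
  have B: "int (card (?B x)) = ?q - 3" if "x \<in> ?A" for x
    using int_card_Compl_set[of "[0, 1, x]"] that by simp
  have "(normal_six :: ('a \<times> 'a \<times> 'a \<times> 'a) set) =
      (SIGMA x : ?A. SIGMA y : ?B x. SIGMA s : ?B x. {t. (x, y, s, t) \<in> normal_six})"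
    by (auto simp: normal_six_def)
  then have "int (card (normal_six :: ('a \<times> 'a \<times> 'a \<times> 'a) set)) =
      (\<Sum>x\<in>?A. \<Sum>y\<in>?B x. \<Sum>s\<in>?B x. int (card {t. (x, y, s, t) \<in> normal_six}))"
    by (metis (no_types, lifting) int_card_Sigma sum.cong)
  also have "\<dots> = (\<Sum>x\<in>?A. \<Sum>y\<in>?B x. (?q - 3) * (?q - 6) + 3)"
  proof (intro sum.cong refl)
    fix x y assume x: "x \<in> ?A" and y: "y \<in> ?B x"
    have "(\<Sum>s\<in>?B x. int (card {t. (x, y, s, t) \<in> normal_six})) =
      (\<Sum>s\<in>?B x. ?q - 6 + of_bool (s = y) + of_bool (s = x / y) + of_bool (s = (y - x) / (y - 1)))"
      using x y by (intro sum.cong refl card_normal_six_fibre) auto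
    moreover have "x / y \<in> ?B x" using x y by (auto simp: field_simps)
    moreover have "(y - x) / (y - 1) \<in> ?B x"
    proof -
      have "(y - x) / (y - 1) \<noteq> x"
      proof
        assume "(y - x) / (y - 1) = x"
        then have "y - x = x * (y - 1)" using y by (simp add: divide_eq_eq)
        then have "y * (1 - x) = 0" by (simp add: algebra_simps)
        with x y show False by simp
      qed
      with x y show ?thesis by (auto simp: divide_eq_1_iff)
    qed
    moreover have "x \<noteq> y" using y by auto
    ultimately show "(\<Sum>s\<in>?B x. int (card {t. (x, y, s, t) \<in> normal_six})) = (?q - 3) * (?q - 6) + 3"
      using B[OF x] x y by (simp only: sum.distrib) (simp add: of_bool_def sum.delta)
  qed
  also have "\<dots> = (\<Sum>x\<in>?A. (?q - 3) * ((?q - 3) * (?q - 6) + 3))"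
    using B by (intro sum.cong refl) simp
  also have "\<dots> = (?q - 2) * ((?q - 3) * ((?q - 3) * (?q - 6) + 3))" using A by simp
  finally show ?thesis by (simp add: algebra_simps power2_eq_square)
qed

text \<open>With \<open>s = x + d\<close> and \<open>t = y + d\<close>, both remaining determinant
  conditions reduce to \<open>(x - y) * d \<noteq> 0\<close>. So \<open>d\<close> only has to avoid
  0, \<open>- x\<close>, \<open>- y\<close>, \<open>1 - x\<close> and \<open>1 - y\<close>, among
  which coincidences arise only for \<open>y = x + 1\<close> and \<open>y = x - 1\<close>.\<close>

lemma card_normal_six_concurrent:
  "int (card {(x, y, s, t) \<in> normal_six. s - x = t - (y :: 'a::{field,finite})}) =
    (int CARD('a) - 2) * (int CARD('a) - 3) * (int CARD('a) - 5) +
    2 * (int CARD('a) - 3 + of_bool ((2 :: 'a) = 0))"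
proof -
  let ?q = "int CARD('a)"
  let ?A = "- {0, 1} :: 'a set" and ?B = "\<lambda>x. - {0, 1, x} :: 'a set"
  let ?D = "\<lambda>x y. - {0, - x, - y, 1 - x, 1 - y} :: 'a set"
  have A: "int (card ?A) = ?q - 2" using int_card_Compl_set[of "[0, 1 :: 'a]"] by simp
  have B: "int (card (?B x)) = ?q - 3" if "x \<in> ?A" for x
    using int_card_Compl_set[of "[0, 1, x]"] that by simp
  have two: "(2 :: 'a) = 0 \<longleftrightarrow> (1 :: 'a) = - 1" by (metis add_eq_0_iff one_add_one)
  have neg: "- a = 1 - b \<longleftrightarrow> b = a + 1" for a b :: 'a
  proof
    assume "- a = 1 - b"
    then have "1 - (1 - b) = 1 - (- a)" by simp
    then show "b = a + 1" by simp
  qed simp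
  \<comment> \<open>The two coincidences are counted separately because in characteristic 2 they
    occur together.\<close>
  have five: "card {z, a, b, c, d} + of_bool (a = d) + of_bool (b = c) = 5"
    if "z \<noteq> a" "z \<noteq> b" "z \<noteq> c" "z \<noteq> d" "a \<noteq> b" "a \<noteq> c" "b \<noteq> d" "c \<noteq> d" for z a b c d :: 'a
    using that by (simp add: card_insert_if)
  let ?f = "\<lambda>(x, y, d). (x, y, x + d, y + d :: 'a)"
  have "{(x, y, s, t) \<in> normal_six. s - x = t - y} = ?f ` (SIGMA x : ?A. SIGMA y : ?B x. ?D x y)"
  proof (intro equalityI subsetI)
    fix w assume "w \<in> {(x, y, s, t) \<in> normal_six. s - x = t - (y :: 'a)}"
    then obtain x y s t where w: "w = (x, y, s, t)" "(x, y, s, t) \<in> normal_six" "s - x = t - y" by auto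
    define d where "d = s - x"
    have st: "s = x + d" "t = y + d" using w(3) by (simp_all add: d_def algebra_simps)
    have "(x, y, d) \<in> (SIGMA x : ?A. SIGMA y : ?B x. ?D x y)"
      using w(2) unfolding st normal_six_def by (auto simp: algebra_simps)
    then show "w \<in> ?f ` (SIGMA x : ?A. SIGMA y : ?B x. ?D x y)"
      unfolding w(1) st by (rule rev_image_eqI) simp
  next
    fix w assume "w \<in> ?f ` (SIGMA x : ?A. SIGMA y : ?B x. ?D x y)"
    then obtain x y d where w: "w = (x, y, x + d, y + d)" and x: "x \<in> ?A" and y: "y \<in> ?B x" and d: "d \<in> ?D x y"
      by auto
    have d': "x + d \<noteq> 0" "y + d \<noteq> 0" "x + d \<noteq> 1" "y + d \<noteq> 1" "d \<noteq> 0"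
      using d by (auto simp: eq_neg_iff_add_eq_0 eq_diff_eq add.commute)
    have "x * (y + d) - y * (x + d) = (x - y) * d" "(x - 1) * (y + d - 1) - (y - 1) * (x + d - 1) = (x - y) * d"
      by (simp_all add: algebra_simps)
    moreover have "(x - y) * d \<noteq> 0" using y d by auto
    ultimately have "x * (y + d) \<noteq> y * (x + d)" "(x - 1) * (y + d - 1) \<noteq> (y - 1) * (x + d - 1)"
      by (metis right_minus_eq)+
    with d' x y show "w \<in> {(x, y, s, t) \<in> normal_six. s - x = t - y}"
      by (simp add: w normal_six_def)
  qed
  moreover have "inj_on ?f (SIGMA x : ?A. SIGMA y : ?B x. ?D x y)" by (auto simp: inj_on_def)
  ultimately have "int (card {(x, y, s, t) \<in> normal_six. s - x = t - (y :: 'a)}) =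
      int (card (SIGMA x : ?A. SIGMA y : ?B x. ?D x y))"
    by (simp only: card_image)
  also have "\<dots> = (\<Sum>x\<in>?A. \<Sum>y\<in>?B x. int (card (?D x y)))"
    by (simp only: int_card_Sigma)
  also have "\<dots> = (\<Sum>x\<in>?A. \<Sum>y\<in>?B x. ?q - 5 + of_bool (y = x + 1) + of_bool (y = x - 1))"
  proof (intro sum.cong refl)
    fix x y assume x: "x \<in> ?A" and y: "y \<in> ?B x"
    have 1: "- x = 1 - y \<longleftrightarrow> y = x + 1" "- y = 1 - x \<longleftrightarrow> y = x - 1"
      using neg[of x y] neg[of y x] by (auto simp only: eq_diff_eq)
    have "card {0, - x, - y, 1 - x, 1 - y} + of_bool (- x = 1 - y) + of_bool (- y = 1 - x) = 5"
    proof (rule five)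
      show "- x \<noteq> 1 - x" "- y \<noteq> 1 - y" using neg[of x x] neg[of y y] by simp_all
    qed (use x y in auto)
    moreover have "card (?D x y) + card {0, - x, - y, 1 - x, 1 - y} = CARD('a)"
      by (rule card_Compl_add)
    ultimately have "card (?D x y) + 5 = CARD('a) + of_bool (- x = 1 - y) + of_bool (- y = 1 - x)" by linarith
    then have "int (card (?D x y) + 5) = int (CARD('a) + of_bool (- x = 1 - y) + of_bool (- y = 1 - x))"
      by (simp only:)
    then show "int (card (?D x y)) = ?q - 5 + of_bool (y = x + 1) + of_bool (y = x - 1)" unfolding 1 by simp
  qed
  \<comment> \<open>The value \<open>x + 1\<close> is admissible for \<open>y\<close> unless it is
    0, and \<open>x - 1\<close> unless it is 1. The exceptions \<open>x = - 1\<close> and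
    \<open>x = 2\<close> are genuine in odd characteristic, but in characteristic 2 they are 1 and
    0, which \<open>x\<close> avoids anyway; each then gains 1.\<close>
  also have "\<dots> = (\<Sum>x\<in>?A. (?q - 3) * (?q - 5) + of_bool (x \<noteq> - 1) + of_bool (x \<noteq> 2))"
  proof (intro sum.cong refl)
    fix x assume x: "x \<in> ?A"
    have "x + 1 \<in> ?B x \<longleftrightarrow> x \<noteq> - 1" "x - 1 \<in> ?B x \<longleftrightarrow> x \<noteq> 2"
      using x by (auto simp: add_eq_0_iff algebra_simps)
    then show "(\<Sum>y\<in>?B x. ?q - 5 + of_bool (y = x + 1) + of_bool (y = x - 1)) =
        (?q - 3) * (?q - 5) + of_bool (x \<noteq> - 1) + of_bool (x \<noteq> 2)"
      using B[OF x] by (simp only: sum.distrib) (simp add: of_bool_def sum.delta)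
  qed
  also have "\<dots> = (?q - 2) * ((?q - 3) * (?q - 5)) + int (card (?A \<inter> {x. x \<noteq> - 1})) + int (card (?A \<inter> {x. x \<noteq> 2}))"
    using A by (simp only: sum.distrib) simp
  also have "int (card (?A \<inter> {x. x \<noteq> - 1})) = ?q - 3 + of_bool ((2 :: 'a) = 0)"
  proof (cases "(2 :: 'a) = 0")
    case True
    then have "?A \<inter> {x. x \<noteq> - 1} = ?A" using two by auto
    with A True show ?thesis by simp
  next
    case False
    then have "distinct [0, 1, - 1 :: 'a]" using two by simp
    moreover have "?A \<inter> {x. x \<noteq> - 1} = - set [0, 1, - 1]" by auto
    ultimately show ?thesis using int_card_Compl_set[of "[0, 1, - 1 :: 'a]"] False by (simp only:) simp
  qed
  also have "int (card (?A \<inter> {x. x \<noteq> 2})) = ?q - 3 + of_bool ((2 :: 'a) = 0)"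
  proof (cases "(2 :: 'a) = 0")
    case True
    then have "?A \<inter> {x. x \<noteq> 2} = ?A" by auto
    with A True show ?thesis by simp
  next
    case False
    moreover have "(2 :: 'a) \<noteq> 1" by (metis add_cancel_right_right one_add_one zero_neq_one)
    ultimately have "distinct [0, 1, 2 :: 'a]" by auto
    moreover have "?A \<inter> {x. x \<noteq> 2} = - set [0, 1, 2]" by auto
    ultimately show ?thesis using int_card_Compl_set[of "[0, 1, 2 :: 'a]"] False by (simp only:) simp
  qed
  finally show ?thesis by (simp add: algebra_simps)
qed

section \<open>From normal forms to lists of vectors\<close>

text \<open>The three vectors arise from (1, 1, 1), (x, y, 1) and (s, t, 1) by the diagonal matrix
  with entries \<open>l1\<close>, \<open>l2\<close>, \<open>l3\<close> and by the scalars
  \<open>m\<close> and \<open>n\<close>, which multiply every determinant in question by a nonzero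
  factor.\<close>

lemma generic_frame_3_scaled:
  fixes x y s t :: "'a::field"
  assumes nz: "l1 \<noteq> 0" "l2 \<noteq> 0" "l3 \<noteq> 0" "m \<noteq> 0" "n \<noteq> 0"
  shows "generic (frame [1, 2, 3 :: 3] @ [vector [l1, l2, l3], vector [m * l1 * x, m * l2 * y, m * l3],
      vector [n * l1 * s, n * l2 * t, n * l3]]) \<longleftrightarrow> (x, y, s, t) \<in> normal_six"
proof -
  \<comment> \<open>Each scaled condition is compared with its normal form by exhibiting the nonzero
    factor between the two differences.\<close>
  have c: "a \<noteq> 0 \<Longrightarrow> p - p' = a * (r - r') \<Longrightarrow> p = p' \<longleftrightarrow> r = r'" for a p p' r r' :: 'a
    by (metis mult_eq_0_iff right_minus_eq)
  have 1: "l1 * (m * l2 * y) = l2 * (m * l1 * x) \<longleftrightarrow> y = x"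
    by (rule c[of "l1 * l2 * m"]) (use nz in \<open>simp_all add: algebra_simps\<close>)
  have 2: "l3 * (m * l1 * x) = l1 * (m * l3) \<longleftrightarrow> x = 1"
    by (rule c[of "l1 * l3 * m"]) (use nz in \<open>simp_all add: algebra_simps\<close>)
  have 3: "l2 * (m * l3) = l3 * (m * l2 * y) \<longleftrightarrow> 1 = y"
    by (rule c[of "l2 * l3 * m"]) (use nz in \<open>simp_all add: algebra_simps\<close>)
  have 4: "l1 * (n * l2 * t) = l2 * (n * l1 * s) \<longleftrightarrow> t = s"
    by (rule c[of "l1 * l2 * n"]) (use nz in \<open>simp_all add: algebra_simps\<close>)
  have 5: "l3 * (n * l1 * s) = l1 * (n * l3) \<longleftrightarrow> s = 1"
    by (rule c[of "l1 * l3 * n"]) (use nz in \<open>simp_all add: algebra_simps\<close>)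
  have 6: "l2 * (n * l3) = l3 * (n * l2 * t) \<longleftrightarrow> 1 = t"
    by (rule c[of "l2 * l3 * n"]) (use nz in \<open>simp_all add: algebra_simps\<close>)
  have 7: "m * l1 * x * (n * l2 * t) = m * l2 * y * (n * l1 * s) \<longleftrightarrow> x * t = y * s"
    by (rule c[of "l1 * l2 * m * n"]) (use nz in \<open>simp_all add: algebra_simps\<close>)
  have 8: "m * l3 * (n * l1 * s) = m * l1 * x * (n * l3) \<longleftrightarrow> s = x"
    by (rule c[of "l1 * l3 * m * n"]) (use nz in \<open>simp_all add: algebra_simps\<close>)
  have 9: "m * l2 * y * (n * l3) = m * l3 * (n * l2 * t) \<longleftrightarrow> y = t"
    by (rule c[of "l2 * l3 * m * n"]) (use nz in \<open>simp_all add: algebra_simps\<close>)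
  have 10: "det3 (vector [l1, l2, l3]) (vector [m * l1 * x, m * l2 * y, m * l3]) (vector [n * l1 * s, n * l2 * t, n * l3]) = 0
    \<longleftrightarrow> (x - 1) * (t - 1) = (y - 1) * (s - 1)"
    by (rule c[of "l1 * l2 * l3 * m * n"]) (use nz in \<open>simp_all add: det3_eq algebra_simps\<close>)
  show ?thesis
    unfolding generic_frame_3_3 10 vector_3 1 2 3 4 5 6 7 8 9 normal_six_def
    using nz by (auto simp del: mult_eq_0_iff)
qed

text \<open>The three diagonal entries and the two scalars are free, which gives the fifth power; a
  property \<open>P\<close> unaffected by them becomes a property \<open>Q\<close> of the normal
  form.\<close>

lemma card_generic_frame_3_3:
  fixes P :: "('a::{field,finite} ^ 3) list \<Rightarrow> bool"
  assumes P: "\<And>l1 l2 l3 m n x y s t. \<lbrakk>l1 \<noteq> 0; l2 \<noteq> 0; l3 \<noteq> 0; m \<noteq> 0; n \<noteq> 0\<rbrakk> \<Longrightarrow>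
    P (frame [1, 2, 3] @ [vector [l1, l2, l3], vector [m * l1 * x, m * l2 * y, m * l3],
      vector [n * l1 * s, n * l2 * t, n * l3]]) \<longleftrightarrow> Q (x, y, s, t)"
  shows "card {ys. length ys = 3 \<and> generic (frame [1, 2, 3] @ ys) \<and> P (frame [1, 2, 3] @ ys)} =
    card (nonzero :: 'a set) ^ 5 * card {w \<in> normal_six. Q w}"
    (is "card ?Y = _ * card ?N")
proof -
  let ?F = "\<lambda>l1 l2 l3 m n x y s t. [vector [l1, l2, l3], vector [m * l1 * x, m * l2 * y, m * l3],
      vector [n * l1 * s, n * l2 * t, n * l3]] :: ('a ^ 3) list"
  let ?f = "\<lambda>(l1, l2, l3, m, n, x, y, s, t). ?F l1 l2 l3 m n x y s t"
  let ?S = "(nonzero :: 'a set) \<times> (nonzero :: 'a set) \<times> (nonzero :: 'a set) \<times> (nonzero :: 'a set) \<times> (nonzero :: 'a set) \<times> ?N"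
  \<comment> \<open>The first vector gives the diagonal entries, the third coordinates of the others
    give \<open>m\<close> and \<open>n\<close>, and the remaining coordinates are divided by both
    scalings.\<close>
  let ?g = "\<lambda>ys :: ('a ^ 3) list. (ys!0$1, ys!0$2, ys!0$3, ys!1$3 / ys!0$3, ys!2$3 / ys!0$3,
    ys!1$1 * ys!0$3 / (ys!1$3 * ys!0$1), ys!1$2 * ys!0$3 / (ys!1$3 * ys!0$2),
    ys!2$1 * ys!0$3 / (ys!2$3 * ys!0$1), ys!2$2 * ys!0$3 / (ys!2$3 * ys!0$2))"
  have S: "\<exists>l1 l2 l3 m n x y s t. p = (l1, l2, l3, m, n, x, y, s, t) \<and>
      l1 \<noteq> 0 \<and> l2 \<noteq> 0 \<and> l3 \<noteq> 0 \<and> m \<noteq> 0 \<and> n \<noteq> 0 \<and> (x, y, s, t) \<in> normal_six \<and> Q (x, y, s, t)"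
    if "p \<in> ?S" for p
  proof -
    obtain l1 l2 l3 m r where r: "p = (l1, l2, l3, m, r)" by (rule prod_cases5)
    obtain n x y s t where "r = (n, x, y, s, t)" by (rule prod_cases5)
    with r that show ?thesis by simp
  qed
  have Y: "\<exists>a b c. ys = [a, b, c] \<and> generic (frame [1, 2, 3] @ [a, b, c]) \<and> P (frame [1, 2, 3] @ [a, b, c])"
    if "ys \<in> ?Y" for ys
    using that by (auto simp: numeral_3_eq_3 length_Suc_conv)
  have fg: "?f (?g [a, b, c]) = [a, b, c]" and g: "?g [a, b, c] \<in> ?S"
    if gen: "generic (frame [1, 2, 3] @ [a, b, c])" and Pabc: "P (frame [1, 2, 3] @ [a, b, c])" for a b c
  proof -
    have nz: "a$1 \<noteq> 0" "a$2 \<noteq> 0" "a$3 \<noteq> 0" "b$3 / a$3 \<noteq> 0" "c$3 / a$3 \<noteq> 0"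
      and bc: "b$3 \<noteq> 0" "c$3 \<noteq> 0"
      using gen unfolding generic_frame_3_3 by simp_all
    show fg: "?f (?g [a, b, c]) = [a, b, c]" using nz bc by (simp add: vec_eq_iff forall_3)
    define x y s t where xyst: "x = b$1 * a$3 / (b$3 * a$1)" "y = b$2 * a$3 / (b$3 * a$2)"
      "s = c$1 * a$3 / (c$3 * a$1)" "t = c$2 * a$3 / (c$3 * a$2)"
    have gabc: "?g [a, b, c] = (a$1, a$2, a$3, b$3 / a$3, c$3 / a$3, x, y, s, t)" by (simp add: xyst)
    have eq: "?F (a$1) (a$2) (a$3) (b$3 / a$3) (c$3 / a$3) x y s t = [a, b, c]"
      using fg unfolding gabc prod.case .
    have "(x, y, s, t) \<in> normal_six" "Q (x, y, s, t)"
      using generic_frame_3_scaled[OF nz, of x y s t] P[OF nz, of x y s t] gen Pabc unfolding eq by blast+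
    then show "?g [a, b, c] \<in> ?S" unfolding gabc using nz by simp
  qed
  have "bij_betw ?f ?S ?Y"
  proof (rule bij_betwI[where g = ?g])
    show "?f \<in> ?S \<rightarrow> ?Y"
    proof
      fix p assume "p \<in> ?S"
      from S[OF this] obtain l1 l2 l3 m n x y s t where p: "p = (l1, l2, l3, m, n, x, y, s, t)"
        and nz: "l1 \<noteq> 0" "l2 \<noteq> 0" "l3 \<noteq> 0" "m \<noteq> 0" "n \<noteq> 0" and N: "(x, y, s, t) \<in> normal_six" "Q (x, y, s, t)"
        by (elim exE conjE) (rule that)
      have "generic (frame [1, 2, 3] @ ?f p)" unfolding p prod.case generic_frame_3_scaled[OF nz] by (rule N(1))
      moreover have "P (frame [1, 2, 3] @ ?f p)" unfolding p prod.case P[OF nz] by (rule N(2))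
      moreover have "length (?f p) = 3" by (simp add: p)
      ultimately show "?f p \<in> ?Y" by blast
    qed
    show "?g \<in> ?Y \<rightarrow> ?S"
    proof
      fix ys assume "ys \<in> ?Y"
      from Y[OF this] show "?g ys \<in> ?S" by (elim exE conjE) (simp only: g)
    qed
    show "?g (?f p) = p" if "p \<in> ?S" for p
      using S[OF that] by (elim exE conjE) (simp add: vector_3)
    show "?f (?g ys) = ys" if "ys \<in> ?Y" for ys
      using Y[OF that] by (elim exE conjE) (simp only: fg)
  qed
  from bij_betw_same_card[OF this] show ?thesis
    by (simp add: card_cartesian_product numeral_eq_Suc)
qed

text \<open>In affine terms the first line is the line at infinity and the second is the diagonal,
  so concurrency means that the line through (x, y) and (s, t) is parallel to the diagonal.\<close>

lemma concurrent_frame_3_scaled: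
  fixes x y s t :: "'a::field"
  assumes nz: "l1 \<noteq> 0" "l2 \<noteq> 0" "l3 \<noteq> 0" "m \<noteq> 0" "n \<noteq> 0"
  shows "concurrent ((!) (frame [1, 2, 3 :: 3] @ [vector [l1, l2, l3], vector [m * l1 * x, m * l2 * y, m * l3],
      vector [n * l1 * s, n * l2 * t, n * l3]])) \<longleftrightarrow> s - x = t - y"
proof -
  have c: "a \<noteq> 0 \<Longrightarrow> p - p' = a * (r - r') \<Longrightarrow> p = p' \<longleftrightarrow> r = r'" for a p p' r r' :: 'a
    by (metis mult_eq_0_iff right_minus_eq)
  show ?thesis unfolding concurrent_def
    by (rule c[of "- (l1 * l2 * l3 * m * n)"])
      (use nz in \<open>simp_all add: frame_def det3_eq axis_def algebra_simps\<close>)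
qed

text \<open>Each side of the equation in \<open>concurrent\<close> is a product of two determinants,
  so both are multiplied by the square of \<open>det M\<close>.\<close>

lemma concurrent_map_mult:
  fixes M :: "'a::field ^ 3 ^ 3"
  assumes "det M \<noteq> 0" "length xs = 6"
  shows "concurrent ((!) (map (\<lambda>x. x v* M) xs)) \<longleftrightarrow> concurrent ((!) xs)"
proof -
  have "det3 (u v* M) (v v* M) (w v* M) = det3 u v w * det M" for u v w
  proof -
    have "(\<chi> i :: 3. if i = 1 then u v* M else if i = 2 then v v* M else w v* M) =
        (\<chi> i. if i = 1 then u else if i = 2 then v else w) ** M"
      by (simp add: vec_eq_iff vector_matrix_mult_def matrix_matrix_mult_def)
    then show ?thesis by (simp add: det3_def det_mul)
  qed
  with assms show ?thesis by (simp add: concurrent_def)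
qed

section \<open>The number of ordered arcs\<close>

theorem theorem1p14:
  fixes q :: int and a :: "int \<Rightarrow> int"
  assumes "primepow q"
    and "int CARD('a::{field,finite}) = q"
    and "\<And>m. a m = (if 2 dvd m then 1 else 0)"
  shows "int (num_ordered_arcs TYPE('a) 4) =
           (q^2 + q + 1) * (q^2 + 1) * (q + 1)^2 * q^6 \<and>
         int (num_ordered_arcs TYPE('a) 5) =
           (q^2 + q + 1) * (q^2 + 1) * (q + 1)^2 * (q - 1)^3 * q^6 \<and>
         int (num_ordered_arcs TYPE('a) 6) =
           (q^2 + q + 1) * (q^2 + 1) * (q + 1)^2 * (q - 1)^3 * (q - 2) * (q - 3) * (q - 4) * q^6 \<and>
         int (num_ordered_arcs TYPE('a) 7) =
           (q^2 + q + 1) * (q^2 + 1) * (q + 1)^2 * (q - 1)^3 * q^6 *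
             (q^6 - 28 * q^5 + 323 * q^4 - 1952 * q^3 + 6462 * q^2 - 11004 * q + 7470 - 30 * a q)"
proof -
  have q: "q = int CARD('a)" using assms(2) by simp
  have "CARD('a) \<ge> 2" using card_mono[of UNIV "{0, 1 :: 'a}"] by simp
  then have q1: "q - 1 \<noteq> 0" using q by simp
  have cancel: "x = y" if "(q - 1) ^ k * x = (q - 1) ^ k * y" for k x y
    using that q1 by simp
  \<comment> \<open>The order of the general linear group with \<open>(q - 1) ^ 4\<close> divided
    out, the common factor of all four counts.\<close>
  define K where "K = (q^2 + q + 1) * (q^2 + 1) * (q + 1)^2 * q^6"
  define \<alpha> :: int where "\<alpha> = of_bool ((2 :: 'a) = 0)"
  have \<alpha>: "a q = \<alpha>"
    using even_card_field_iff[where 'a = 'a] assms(1) unfolding \<alpha>_def assms(3) q by simp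
  define N where "N = q^6 - 28 * q^5 + 323 * q^4 - 1952 * q^3 + 6462 * q^2 - 11004 * q + 7470 - 30 * \<alpha>"
  have nonzero: "int (card (nonzero :: 'a set)) = q - 1" unfolding q by (rule card_nonzero)

  have GL4: "int (card {M :: 'a ^ 4 ^ 4. det M \<noteq> 0}) = (q - 1) ^ 4 * K"
  proof -
    have d: "int (CARD('a) ^ 4 - CARD('a) ^ i) = q ^ 4 - q ^ i" if "i \<le> 4" for i
      using that \<open>CARD('a) \<ge> 2\<close> by (simp add: q of_nat_diff power_increasing)
    have "int (card {M :: 'a ^ 4 ^ 4. det M \<noteq> 0}) = (\<Prod>i<4. int (CARD('a) ^ 4 - CARD('a) ^ i))"
      unfolding card_det_nonzero by simp
    also have "\<dots> = (\<Prod>i<4. q ^ 4 - q ^ i)" by (intro prod.cong refl d) simp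
    also have "\<dots> = (q ^ 4 - 1) * (q ^ 4 - q) * (q ^ 4 - q ^ 2) * (q ^ 4 - q ^ 3)"
      by (simp add: numeral_eq_Suc)
    also have "q ^ 4 - 1 = (q - 1) * ((q + 1) * (q^2 + 1))" by (simp add: numeral_eq_Suc algebra_simps)
    also have "q ^ 4 - q = (q - 1) * (q * (q^2 + q + 1))" by (simp add: numeral_eq_Suc algebra_simps)
    also have "q ^ 4 - q ^ 2 = (q - 1) * (q^2 * (q + 1))" by (simp add: numeral_eq_Suc algebra_simps)
    also have "q ^ 4 - q ^ 3 = (q - 1) * q^3" by (simp add: numeral_eq_Suc algebra_simps)
    also have "(q - 1) * ((q + 1) * (q^2 + 1)) * ((q - 1) * (q * (q^2 + q + 1))) * ((q - 1) * (q^2 * (q + 1))) * ((q - 1) * q^3) =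
        (q - 1) ^ 4 * K" unfolding K_def by (simp add: numeral_eq_Suc mult_ac)
    finally show ?thesis .
  qed
  have arcs: "(q - 1) ^ (4 + k) * int (num_ordered_arcs TYPE('a) (4 + k)) =
      (q - 1) ^ 4 * K * int (card {ys :: ('a ^ 4) list. length ys = k \<and> generic (frame [1, 2, 3, 4] @ ys)})" for k
  proof -
    have "set [1, 2, 3, 4 :: 4] = UNIV" unfolding UNIV_4 by simp
    then have "card {vs :: ('a ^ 4) list. length vs = CARD(4) + k \<and> generic vs \<and> True} =
      card {M :: 'a ^ 4 ^ 4. det M \<noteq> 0} *
      card {ys :: ('a ^ 4) list. length ys = k \<and> generic (frame [1, 2, 3, 4] @ ys) \<and> True}"
      by (intro card_generic_frame) auto
    then have "(CARD('a) - 1) ^ (4 + k) * num_ordered_arcs TYPE('a) (4 + k) =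
      card {M :: 'a ^ 4 ^ 4. det M \<noteq> 0} *
      card {ys :: ('a ^ 4) list. length ys = k \<and> generic (frame [1, 2, 3, 4] @ ys)}"
      using card_generic_eq_num_ordered_arcs[of "4 + k", where 'a = 'a] by simp
    then have "int ((CARD('a) - 1) ^ (4 + k) * num_ordered_arcs TYPE('a) (4 + k)) =
      int (card {M :: 'a ^ 4 ^ 4. det M \<noteq> 0} *
      card {ys :: ('a ^ 4) list. length ys = k \<and> generic (frame [1, 2, 3, 4] @ ys)})"
      by (simp only:)
    moreover have "int (CARD('a) - 1) = q - 1" using \<open>CARD('a) \<ge> 2\<close> q by simp
    ultimately show ?thesis by (simp only: of_nat_mult of_nat_power GL4)
  qed

  \<comment> \<open>The frame is generic as an initial segment of the frame followed by the all-ones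
    vector.\<close>
  have "{ys :: ('a ^ 4) list. length ys = 0 \<and> generic (frame [1, 2, 3, 4] @ ys)} = {[]}"
    using generic_frame_4_1[of "1 :: 'a ^ 4"] generic_append_left by auto
  then have C4: "int (num_ordered_arcs TYPE('a) 4) = K"
    using arcs[of 0] q1 by simp

  have C5: "int (num_ordered_arcs TYPE('a) 5) = (q - 1)^3 * K"
  proof -
    have "(q - 1)^5 * int (num_ordered_arcs TYPE('a) 5) = (q - 1)^4 * K * (q - 1)^4"
      using arcs[of 1] nonzero unfolding card_frame_4_1 by simp
    also have "\<dots> = (q - 1)^5 * ((q - 1)^3 * K)" by (simp add: numeral_eq_Suc mult_ac)
    finally show ?thesis by (rule cancel)
  qed

  have C6: "int (num_ordered_arcs TYPE('a) 6) = (q - 1)^3 * (q - 2) * (q - 3) * (q - 4) * K"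
  proof -
    have "(q - 1)^6 * int (num_ordered_arcs TYPE('a) 6) =
        (q - 1)^4 * K * ((q - 1)^4 * ((q - 1) * (q - 2) * (q - 3) * (q - 4)))"
      using arcs[of 2] unfolding card_frame_4_2 of_nat_mult of_nat_power int_card_distinct_lists_4 nonzero by simp
    also have "\<dots> = (q - 1)^6 * ((q - 1)^3 * (q - 2) * (q - 3) * (q - 4) * K)" by (simp add: numeral_eq_Suc mult_ac)
    finally show ?thesis by (rule cancel)
  qed

  let ?E3 = "card {xs :: ('a ^ 3) list. length xs = 4 \<and> generic (frame [1, 2, 3] @ xs)}"
  have E3: "int ?E3 = (q - 1)^6 * N"
  proof -
    \<comment> \<open>The plane seven-arcs are counted both through completions of the frame and
      through extensions of six-arcs. The order of the group in dimension three occurs on both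
      sides, so only its being nonzero is needed.\<close>
    let ?G = "card {M :: 'a ^ 3 ^ 3. det M \<noteq> 0}"
    have un: "distinct [1, 2, 3 :: 3]" "set [1, 2, 3 :: 3] = UNIV" unfolding UNIV_3 by simp_all
    have G: "int ?G \<noteq> 0"
    proof -
      have "mat 1 \<in> {M :: 'a ^ 3 ^ 3. det M \<noteq> 0}" by (simp add: det_I)
      then show ?thesis by (metis card_0_eq empty_iff finite of_nat_eq_0_iff)
    qed
    have W7: "card {vs :: ('a ^ 3) list. length vs = 7 \<and> generic vs} = ?G * ?E3"
      using card_generic_frame[OF un, where k = 4 and 'a = 'a and P = "\<lambda>_. True"] by simp
    have W6: "card {vs :: ('a ^ 3) list. length vs = 6 \<and> generic vs} =
        ?G * (card (nonzero :: 'a set) ^ 5 * card (normal_six :: ('a \<times> 'a \<times> 'a \<times> 'a) set))"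
      using card_generic_frame[OF un, where k = 3 and 'a = 'a and P = "\<lambda>_. True"]
        card_generic_frame_3_3[where P = "\<lambda>_. True" and Q = "\<lambda>_. True" and 'a = 'a] by simp
    have B: "card {vs :: ('a ^ 3) list. length vs = 6 \<and> generic vs \<and> concurrent ((!) vs)} =
        ?G * (card (nonzero :: 'a set) ^ 5 * card {(x, y, s, t) \<in> normal_six. s - x = t - (y :: 'a)})"
    proof -
      have "card {ys :: ('a ^ 3) list. length ys = 3 \<and> generic (frame [1, 2, 3] @ ys) \<and> concurrent ((!) (frame [1, 2, 3] @ ys))} =
          card (nonzero :: 'a set) ^ 5 * card {w \<in> normal_six. (\<lambda>(x, y, s, t). s - x = t - (y :: 'a)) w}"
        by (rule card_generic_frame_3_3, unfold prod.case, rule concurrent_frame_3_scaled)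
      moreover have "card {vs :: ('a ^ 3) list. length vs = CARD(3) + 3 \<and> generic vs \<and> concurrent ((!) vs)} =
          ?G * card {ys :: ('a ^ 3) list. length ys = 3 \<and> generic (frame [1, 2, 3] @ ys) \<and> concurrent ((!) (frame [1, 2, 3] @ ys))}"
        by (rule card_generic_frame[OF un]) (simp add: concurrent_map_mult)
      moreover have "{(x, y, s, t) \<in> normal_six. s - x = t - (y :: 'a)} = {w \<in> normal_six. (\<lambda>(x, y, s, t). s - x = t - (y :: 'a)) w}"
        by auto
      ultimately show ?thesis by simp
    qed
    \<comment> \<open>Stated for arbitrary integers, so that the common factors are extracted before
      any polynomial in \<open>q\<close> is expanded.\<close>
    have factor: "r * (A * (g * (r^5 * X)) - 15 * (g * (r^5 * Y))) = g * (r^6 * (A * X - 15 * Y))" for g r A X Y :: int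
      by (simp add: algebra_simps numeral_eq_Suc)
    have "int ?G * int ?E3 = (q - 1) * ((q^2 - 14 * q + 55) * (int ?G * ((q - 1)^5 * ((q - 2) * (q - 3) * (q^2 - 9 * q + 21))))
        - 15 * (int ?G * ((q - 1)^5 * ((q - 2) * (q - 3) * (q - 5) + 2 * (q - 3 + \<alpha>)))))"
      using card_generic_3_7[where 'a = 'a]
      unfolding W7 W6 B of_nat_mult of_nat_power nonzero card_normal_six card_normal_six_concurrent \<alpha>_def q by (simp only:)
    also have "\<dots> = int ?G * ((q - 1)^6 * ((q^2 - 14 * q + 55) * ((q - 2) * (q - 3) * (q^2 - 9 * q + 21))
        - 15 * ((q - 2) * (q - 3) * (q - 5) + 2 * (q - 3 + \<alpha>))))"
      by (rule factor)
    also have "(q^2 - 14 * q + 55) * ((q - 2) * (q - 3) * (q^2 - 9 * q + 21))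
        - 15 * ((q - 2) * (q - 3) * (q - 5) + 2 * (q - 3 + \<alpha>)) = N"
      unfolding N_def by (simp add: algebra_simps numeral_eq_Suc)
    finally have "int ?G * int ?E3 = int ?G * ((q - 1)^6 * N)" .
    then show ?thesis by (rule mult_left_cancel[OF G, THEN iffD1])
  qed
  have C7: "int (num_ordered_arcs TYPE('a) 7) = (q - 1)^3 * K * N"
  proof -
    have "(q - 1)^7 * int (num_ordered_arcs TYPE('a) 7) = (q - 1)^4 * K * ((q - 1)^6 * N)"
      using arcs[of 3] unfolding card_frame_4_3 E3 by simp
    also have "\<dots> = (q - 1)^7 * ((q - 1)^3 * K * N)" by (simp add: numeral_eq_Suc mult_ac)
    finally show ?thesis by (rule cancel)
  qed
  show ?thesis
    unfolding C4 C5 C6 C7 \<alpha> K_def N_def by (simp only: mult_ac)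
qed

end
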